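(* Let $k,n,m\geq 2$ be integers with $n<m$ and $n,m$ coprime. The center of $W(k,n,m)$ is cyclic, generated by $c=(x_1x_2\cdots x_n)^m$.
   Context: Toric reflection group: $W(k,n,m)$ is the group with generators $x_1,\dots,x_n$ and relations $x_i^k=1$ for $i=1,\dots,n$, and $x_1x_2\cdots x_m=x_ix_{i+1}\cdots x_{i+m-1}$ for $i=2,\dots,n$, indices of the $x_j$ being taken modulo $n$. *)

theory Defs
  imports "HOL-Algebra.Algebra"
begin

text \<open>The letter \<open>(x, True)\<close> stands for the generator \<open>x\<close> and \<open>(x, False)\<close> for its formal inverse.\<close>

type_synonym 'a gword = "('a \<times> bool) list"

definition gwords :: "'a set \<Rightarrow> 'a gword set" where
  "gwords S = lists (S \<times> UNIV)"

text \<open>A pair \<open>(r, s)\<close> in \<open>R\<close> is the relation \<open>r = s\<close>.\<close>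

inductive_set gword_rel :: "'a set \<Rightarrow> ('a gword \<times> 'a gword) set \<Rightarrow> ('a gword \<times> 'a gword) set"
  for S :: "'a set" and R :: "('a gword \<times> 'a gword) set" where
  refl: "w \<in> gwords S \<Longrightarrow> (w, w) \<in> gword_rel S R"
| sym: "(v, w) \<in> gword_rel S R \<Longrightarrow> (w, v) \<in> gword_rel S R"
| trans: "(u, v) \<in> gword_rel S R \<Longrightarrow> (v, w) \<in> gword_rel S R \<Longrightarrow> (u, w) \<in> gword_rel S R"
| cancel: "u \<in> gwords S \<Longrightarrow> v \<in> gwords S \<Longrightarrow> x \<in> S \<Longrightarrow>
    (u @ [(x, b), (x, \<not> b)] @ v, u @ v) \<in> gword_rel S R"
| relation: "u \<in> gwords S \<Longrightarrow> v \<in> gwords S \<Longrightarrow> (r, s) \<in> R \<Longrightarrow> r \<in> gwords S \<Longrightarrow> s \<in> gwords S \<Longrightarrow>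
    (u @ r @ v, u @ s @ v) \<in> gword_rel S R"

definition presented_group ::
    "'a set \<Rightarrow> ('a gword \<times> 'a gword) set \<Rightarrow> 'a gword set monoid" where
  "presented_group S R =
    \<lparr>carrier = gwords S // gword_rel S R,
     monoid.mult = (\<lambda>A B. \<Union>a\<in>A. \<Union>b\<in>B. gword_rel S R `` {a @ b}),
     one = gword_rel S R `` {[]}\<rparr>"

lemma gwords_simps [simp]:
  "[] \<in> gwords S"
  "a # w \<in> gwords S \<longleftrightarrow> fst a \<in> S \<and> w \<in> gwords S"
  "v @ w \<in> gwords S \<longleftrightarrow> v \<in> gwords S \<and> w \<in> gwords S"
  by (auto simp: gwords_def mem_Times_iff)

lemma gword_rel_in: "(v, w) \<in> gword_rel S R \<Longrightarrow> v \<in> gwords S \<and> w \<in> gwords S"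
  by (induction rule: gword_rel.induct) auto

lemma equiv_gword_rel: "equiv (gwords S) (gword_rel S R)"
  by (intro equivI refl_onI symI transI)
     (auto dest: gword_rel_in intro: gword_rel.refl gword_rel.sym gword_rel.trans)

lemma gword_rel_context:
  assumes "(v, w) \<in> gword_rel S R" "p \<in> gwords S" "q \<in> gwords S"
  shows "(p @ v @ q, p @ w @ q) \<in> gword_rel S R"
  using assms
proof (induction rule: gword_rel.induct)
  case (cancel u v x b)
  then show ?case using gword_rel.cancel[of "p @ u" S "v @ q" x b R] by simp
next
  case (relation u v r s)
  then show ?case using gword_rel.relation[of "p @ u" S "v @ q" r s R] by simp
qed (auto intro: gword_rel.refl gword_rel.sym gword_rel.trans)

lemma gword_rel_append:
  assumes "(v, v') \<in> gword_rel S R" "(w, w') \<in> gword_rel S R"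
  shows "(v @ w, v' @ w') \<in> gword_rel S R"
proof -
  have "(v @ w, v' @ w) \<in> gword_rel S R" "(v' @ w, v' @ w') \<in> gword_rel S R"
    using gword_rel_context[OF assms(1), of "[]" w] gword_rel_context[OF assms(2), of v' "[]"]
      assms[THEN gword_rel_in] by auto
  then show ?thesis by (rule gword_rel.trans)
qed

lemma presented_group_mult:
  assumes "v \<in> gwords S" "w \<in> gwords S"
  shows "gword_rel S R `` {v} \<otimes>\<^bsub>presented_group S R\<^esub> gword_rel S R `` {w} =
    gword_rel S R `` {v @ w}"
proof -
  have "congruent2 (gword_rel S R) (gword_rel S R) (\<lambda>a b. gword_rel S R `` {a @ b})"
    unfolding congruent2_def
    using equiv_class_eq[OF equiv_gword_rel gword_rel_append] by fastforce
  from UN_equiv_class2[OF equiv_gword_rel equiv_gword_rel this assms]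
  show ?thesis by (simp add: presented_group_def)
qed

lemma gwords_inverse: "w \<in> gwords S \<Longrightarrow> rev (map (map_prod id Not) w) \<in> gwords S"
  by (induction w) auto

lemma gword_rel_inverse:
  assumes "w \<in> gwords S"
  shows "(rev (map (map_prod id Not) w) @ w, []) \<in> gword_rel S R"
  using assms
proof (induction w)
  case Nil
  then show ?case by (auto intro: gword_rel.refl)
next
  case (Cons a w)
  let ?i = "rev (map (map_prod id Not) w)"
  obtain x b where a: "a = (x, b)" by (cases a)
  have i: "?i \<in> gwords S"
    using Cons.prems by (simp add: gwords_inverse)
  have "(?i @ [(x, \<not> b), (x, \<not> \<not> b)] @ w, ?i @ w) \<in> gword_rel S R"
    using Cons.prems i a by (intro gword_rel.cancel) auto
  with Cons show ?case using a by (auto simp: id_def intro: gword_rel.trans)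
qed

lemma group_presented_group: "group (presented_group S R)"
proof (rule groupI)
  let ?G = "presented_group S R"
  have car: "carrier ?G = gwords S // gword_rel S R" and one: "\<one>\<^bsub>?G\<^esub> = gword_rel S R `` {[]}"
    by (simp_all add: presented_group_def)
  show "\<one>\<^bsub>?G\<^esub> \<in> carrier ?G"
    by (simp add: car one quotientI)
  show "A \<otimes>\<^bsub>?G\<^esub> B \<in> carrier ?G" if "A \<in> carrier ?G" "B \<in> carrier ?G" for A B
    using that unfolding car by (auto elim!: quotientE simp: presented_group_mult intro!: quotientI)
  show "A \<otimes>\<^bsub>?G\<^esub> B \<otimes>\<^bsub>?G\<^esub> C = A \<otimes>\<^bsub>?G\<^esub> (B \<otimes>\<^bsub>?G\<^esub> C)"
    if "A \<in> carrier ?G" "B \<in> carrier ?G" "C \<in> carrier ?G" for A B C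
    using that unfolding car by (auto elim!: quotientE simp: presented_group_mult)
  show "\<one>\<^bsub>?G\<^esub> \<otimes>\<^bsub>?G\<^esub> A = A" if "A \<in> carrier ?G" for A
    using that unfolding car one by (auto elim!: quotientE simp: presented_group_mult)
  show "\<exists>B\<in>carrier ?G. B \<otimes>\<^bsub>?G\<^esub> A = \<one>\<^bsub>?G\<^esub>" if "A \<in> carrier ?G" for A
  proof -
    from that obtain w where w: "w \<in> gwords S" and A: "A = gword_rel S R `` {w}"
      unfolding car by (auto elim: quotientE)
    let ?i = "rev (map (map_prod id Not) w)"
    have i: "?i \<in> gwords S"
      using w by (rule gwords_inverse)
    have "gword_rel S R `` {?i} \<otimes>\<^bsub>?G\<^esub> A = \<one>\<^bsub>?G\<^esub>"
      using equiv_class_eq[OF equiv_gword_rel gword_rel_inverse[OF w]]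
      by (simp add: A presented_group_mult[OF i w] one)
    then show ?thesis using i by (auto simp: car intro: quotientI)
  qed
qed

primrec gword_eval :: "('b, 'c) monoid_scheme \<Rightarrow> ('a \<Rightarrow> 'b) \<Rightarrow> 'a gword \<Rightarrow> 'b" where
  "gword_eval H f [] = \<one>\<^bsub>H\<^esub>"
| "gword_eval H f (a # w) =
    (if snd a then f (fst a) else inv\<^bsub>H\<^esub> f (fst a)) \<otimes>\<^bsub>H\<^esub> gword_eval H f w"

context group
begin

lemma gword_eval_closed:
  "f \<in> S \<rightarrow> carrier G \<Longrightarrow> w \<in> gwords S \<Longrightarrow> gword_eval G f w \<in> carrier G"
  by (induction w) (auto simp: Pi_iff)

lemma gword_eval_append:
  assumes "f \<in> S \<rightarrow> carrier G" "v \<in> gwords S" "w \<in> gwords S"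
  shows "gword_eval G f (v @ w) = gword_eval G f v \<otimes> gword_eval G f w"
  using assms(2)
proof (induction v)
  case Nil
  then show ?case using gword_eval_closed[OF assms(1,3)] by simp
next
  case (Cons a v)
  then have "fst a \<in> S" "v \<in> gwords S" by auto
  then have "f (fst a) \<in> carrier G" "gword_eval G f v \<in> carrier G"
    using assms(1) gword_eval_closed by auto
  then show ?case
    using Cons gword_eval_closed[OF assms(1,3)] by (auto simp: m_assoc)
qed

lemma gword_eval_respects:
  assumes f: "f \<in> S \<rightarrow> carrier G"
    and R: "\<And>r s. (r, s) \<in> R \<Longrightarrow> gword_eval G f r = gword_eval G f s"
    and vw: "(v, w) \<in> gword_rel S R"
  shows "gword_eval G f v = gword_eval G f w"
  using vw
proof (induction rule: gword_rel.induct)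
  case (cancel u v x b)
  then have x: "f x \<in> carrier G" using f by auto
  have "gword_eval G f ([(x, b), (x, \<not> b)] @ v) = gword_eval G f v"
    using x gword_eval_closed[OF f cancel(2)] by (auto simp: m_assoc[symmetric])
  then show ?case using cancel by (simp add: gword_eval_append[OF f] del: append.simps)
next
  case (relation u v r s)
  then show ?case by (simp add: gword_eval_append[OF f] R)
qed auto

lemma presented_group_universal:
  assumes f: "f \<in> S \<rightarrow> carrier G"
    and R: "\<And>r s. (r, s) \<in> R \<Longrightarrow> gword_eval G f r = gword_eval G f s"
  obtains h where "h \<in> hom (presented_group S R) G"
    and "\<And>w. w \<in> gwords S \<Longrightarrow> h (gword_rel S R `` {w}) = gword_eval G f w"
proof -
  define h where "h A = gword_eval G f (SOME w. w \<in> A)" for A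
  have h: "h (gword_rel S R `` {w}) = gword_eval G f w" if w: "w \<in> gwords S" for w
  proof -
    have "(SOME v. v \<in> gword_rel S R `` {w}) \<in> gword_rel S R `` {w}"
      by (rule someI[of _ w]) (auto intro: gword_rel.refl w)
    then show ?thesis
      using gword_eval_respects[OF f R] unfolding h_def by (metis Image_singleton_iff)
  qed
  have "h \<in> hom (presented_group S R) G"
  proof (rule homI)
    fix A assume "A \<in> carrier (presented_group S R)"
    then show "h A \<in> carrier G"
      by (auto simp: presented_group_def h gword_eval_closed[OF f] elim!: quotientE)
  next
    fix A B assume "A \<in> carrier (presented_group S R)" "B \<in> carrier (presented_group S R)"
    then obtain v w where "v \<in> gwords S" "w \<in> gwords S"
      and "A = gword_rel S R `` {v}" "B = gword_rel S R `` {w}"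
      by (auto simp: presented_group_def elim!: quotientE)
    then show "h (A \<otimes>\<^bsub>presented_group S R\<^esub> B) = h A \<otimes> h B"
      by (simp add: presented_group_mult h gword_eval_append[OF f])
  qed
  with h show thesis using that by blast
qed

end

text \<open>The generators are labelled by the residues \<open>0, \<dots>, n - 1\<close>, so \<open>x\<^sub>j\<close> is the letter
  \<open>j mod n\<close>; in particular \<open>x\<^sub>n\<close> carries the label \<open>0\<close>.\<close>

definition toric_word :: "nat \<Rightarrow> nat \<Rightarrow> nat \<Rightarrow> nat gword" where
  "toric_word n i l = map (\<lambda>j. (j mod n, True)) [i..<i + l]"

definition toric_relations :: "nat \<Rightarrow> nat \<Rightarrow> nat \<Rightarrow> (nat gword \<times> nat gword) set" where
  "toric_relations k n m =
    {(replicate k (i mod n, True), []) | i. i \<in> {1..n}} \<union>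
    {(toric_word n 1 m, toric_word n i m) | i. i \<in> {2..n}}"

definition toric_reflection_group :: "nat \<Rightarrow> nat \<Rightarrow> nat \<Rightarrow> nat gword set monoid" where
  "toric_reflection_group k n m = presented_group {0..<n} (toric_relations k n m)"

definition toric_gen :: "nat \<Rightarrow> nat \<Rightarrow> nat \<Rightarrow> nat \<Rightarrow> nat gword set" where
  "toric_gen k n m j = gword_rel {0..<n} (toric_relations k n m) `` {[(j mod n, True)]}"

definition toric_c :: "nat \<Rightarrow> nat \<Rightarrow> nat \<Rightarrow> nat gword set" where
  "toric_c k n m =
    (let W = toric_reflection_group k n m
     in (foldr (monoid.mult W) (map (toric_gen k n m) [1..<n + 1]) \<one>\<^bsub>W\<^esub>) [^]\<^bsub>W\<^esub> m)"

definition group_center :: "('a, 'b) monoid_scheme \<Rightarrow> 'a set" where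
  "group_center G = {z \<in> carrier G. \<forall>g\<in>carrier G. z \<otimes>\<^bsub>G\<^esub> g = g \<otimes>\<^bsub>G\<^esub> z}"

end

theory Submission
  imports Defs "HOL-Analysis.Determinants"
begin

text \<open>Let \<open>y = x\<^sub>1 \<cdots> x\<^sub>m\<close>. Conjugation by \<open>y\<close> shifts the indices of the generators by \<open>m\<close>, so
  \<open>c = y\<^sup>n\<close> is central. Choose \<open>p\<close> and \<open>s\<close> with \<open>p m = 1 + s n\<close>; conjugation by \<open>Y = y\<^sup>p\<close> shifts the
  indices by \<open>1\<close>, and \<open>W/\<langle>c\<rangle>\<close> is the triangle group generated by \<open>x = x\<^sub>0\<close> and \<open>Y\<close> with relations
  \<open>x\<^sup>k = Y\<^sup>n = (x Y\<inverse>)\<^sup>m = 1\<close>, that is, the even subgroup of the Coxeter group with \<open>Y = r\<^sub>1 r\<^sub>2\<close> and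
  \<open>x = r\<^sub>3 r\<^sub>2\<close>. A central element of \<open>W\<close> acts in the geometric representation by a map commuting with all
  \<open>r\<^sub>i r\<^sub>j\<close>. Such a map preserves the lines of the simple roots and has determinant \<open>1\<close>. If two of the three
  orders exceed \<open>2\<close>, it is a scalar, hence \<open>1\<close>; otherwise \<open>k = n = 2\<close>, and the oddness of \<open>m\<close> decides.
  Since the geometric representation is faithful (Tits), the element is trivial modulo \<open>c\<close>.\<close>

subsection \<open>The geometric representation of a Coxeter group\<close>

locale coxeter_matrix =
  fixes M :: "'n::finite \<Rightarrow> 'n \<Rightarrow> nat"
  assumes diag: "M i i = 1" and M_sym: "M i j = M j i" and off_diag: "i \<noteq> j \<Longrightarrow> 2 \<le> M i j"
begin

text \<open>This is Tits' bilinear form in the basis of simple roots. The diagonal entries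
  \<open>M i i = 1\<close> make the roots unit vectors.\<close>

definition gram :: "'n \<Rightarrow> 'n \<Rightarrow> real" where
  "gram i j = - cos (pi / M i j)"

definition pairing :: "'n \<Rightarrow> real^'n \<Rightarrow> real" where
  "pairing i v = (\<Sum>j\<in>UNIV. gram i j * v $ j)"

abbreviation root :: "'n \<Rightarrow> real^'n" where
  "root i \<equiv> axis i 1"

definition reflection :: "'n \<Rightarrow> real^'n \<Rightarrow> real^'n" where
  "reflection i v = v - (2 * pairing i v) *\<^sub>R root i"

definition act :: "'n list \<Rightarrow> real^'n \<Rightarrow> real^'n" where
  "act w = foldr reflection w"

lemma gram_self [simp]: "gram i i = 1"
  by (simp add: gram_def diag)

lemma gram_sym: "gram i j = gram j i"
  by (simp add: gram_def M_sym)

lemma pairing_root [simp]: "pairing i (root j) = gram i j"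
  by (simp add: pairing_def axis_def if_distrib cong: if_cong)

lemma linear_pairing: "linear (pairing i)"
  by (rule linearI) (simp_all add: pairing_def sum.distrib algebra_simps sum_distrib_left)

lemma linear_reflection: "linear (reflection i)"
  by (rule linearI)
     (simp_all add: reflection_def linear_add[OF linear_pairing] linear_scale[OF linear_pairing]
       algebra_simps)

lemma pairing_simps [simp]:
  "pairing i (u + v) = pairing i u + pairing i v"
  "pairing i (u - v) = pairing i u - pairing i v"
  "pairing i (- v) = - pairing i v"
  "pairing i (c *\<^sub>R v) = c * pairing i v"
  by (simp_all add: linear_add[OF linear_pairing] linear_diff[OF linear_pairing]
      linear_neg[OF linear_pairing] linear_scale[OF linear_pairing])

lemma reflection_simps [simp]:
  "reflection i (u + v) = reflection i u + reflection i v"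
  "reflection i (u - v) = reflection i u - reflection i v"
  "reflection i (- v) = - reflection i v"
  "reflection i (c *\<^sub>R v) = c *\<^sub>R reflection i v"
  by (simp_all add: linear_add[OF linear_reflection] linear_diff[OF linear_reflection]
      linear_neg[OF linear_reflection] linear_scale[OF linear_reflection])

lemma reflection_root: "reflection i (root j) = root j - (2 * gram i j) *\<^sub>R root i"
  by (simp add: reflection_def)

lemma reflection_root_self [simp]: "reflection i (root i) = - root i"
  by (simp add: reflection_root scaleR_2)

lemma reflection_reflection [simp]: "reflection i (reflection i v) = v"
proof -
  have "pairing i (reflection i v) = - pairing i v"
    by (simp add: reflection_def)
  then show ?thesis by (simp add: reflection_def[of i "reflection i v"]) (simp add: reflection_def)
qed

lemma act_Nil [simp]: "act [] = id"
  and act_Cons [simp]: "act (i # w) = reflection i \<circ> act w"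
  by (simp_all add: act_def)

lemma act_append: "act (u @ w) = act u \<circ> act w"
  by (induction u) auto

lemma linear_act: "linear (act w)"
  by (induction w)
     (auto simp: linear_ident id_def intro: linear_compose linear_reflection simp del: o_apply)

lemma act_simps [simp]:
  "act w (u + v) = act w u + act w v"
  "act w (u - v) = act w u - act w v"
  "act w (- v) = - act w v"
  "act w (c *\<^sub>R v) = c *\<^sub>R act w v"
  by (simp_all add: linear_add[OF linear_act] linear_diff[OF linear_act]
      linear_neg[OF linear_act] linear_scale[OF linear_act])

lemma act_rev_act [simp]: "act (rev w) (act w v) = v"
  by (induction w arbitrary: v) (simp_all add: act_append)

lemma bij_act: "bij (act w)"
  using act_rev_act[of w] act_rev_act[of "rev w"]
  by (intro o_bij[of "act (rev w)"]) (auto simp: fun_eq_iff)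

section \<open>Rotations generated by two simple reflections\<close>

lemma angle:
  assumes "i \<noteq> j"
  shows "sin (pi / M i j) > 0" "gram i j ^ 2 < 1"
proof -
  have M: "real (M i j) \<ge> 2"
    using off_diag[OF assms] by linarith
  have "pi / M i j < pi" using M pi_gt_zero by (simp add: divide_less_eq)
  moreover have "pi / M i j > 0" using M by auto
  ultimately show s: "sin (pi / M i j) > 0" by (rule sin_gt_zero[rotated])
  show "gram i j ^ 2 < 1"
  proof -
    have "gram i j ^ 2 = 1 - sin (pi / M i j) ^ 2"
      by (simp add: gram_def cos_squared_eq)
    also have "\<dots> < 1" using zero_less_power[OF s, of 2] by linarith
    finally show ?thesis .
  qed
qed

lemma sin_step: "2 * cos t * sin ((x + 1) * t) - sin (x * t) = sin ((x + 2) * (t::real))"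
proof -
  have "sin (x * t) = sin ((x + 1) * t - t)" "sin ((x + 2) * t) = sin ((x + 1) * t + t)"
    by (simp_all add: algebra_simps)
  then show ?thesis by (simp add: sin_add sin_diff)
qed

text \<open>In the plane of the two roots the product is a rotation by \<open>2 * t\<close>. The
  factor \<open>sin t\<close> clears denominators; each reflection advances one coefficient by
  \<open>sin_step\<close>.\<close>

lemma funpow_rotation_root:
  assumes "i \<noteq> j"
  defines "t \<equiv> pi / M i j"
  shows "sin t *\<^sub>R ((reflection i \<circ> reflection j) ^^ q) (root i) =
    sin ((2 * real q + 1) * t) *\<^sub>R root i + sin (2 * real q * t) *\<^sub>R root j"
proof (induction q)
  case (Suc q)
  have g: "gram i j = - cos t" "gram j i = - cos t"
    by (simp_all add: gram_def t_def M_sym)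
  let ?r = "reflection i \<circ> reflection j"
  have "sin t *\<^sub>R (?r ^^ Suc q) (root i) = ?r (sin t *\<^sub>R (?r ^^ q) (root i))"
    by simp
  also have "\<dots> = ?r (sin ((2 * real q + 1) * t) *\<^sub>R root i + sin (2 * real q * t) *\<^sub>R root j)"
    by (simp only: Suc)
  also have "\<dots> = reflection i (sin ((2 * real q + 1) * t) *\<^sub>R root i
      + (2 * cos t * sin ((2 * real q + 1) * t) - sin (2 * real q * t)) *\<^sub>R root j)"
    by (simp add: reflection_root g algebra_simps)
  also have "2 * cos t * sin ((2 * real q + 1) * t) - sin (2 * real q * t) = sin ((2 * real q + 2) * t)"
    by (rule sin_step)
  also have "reflection i (sin ((2 * real q + 1) * t) *\<^sub>R root i + sin ((2 * real q + 2) * t) *\<^sub>R root j)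
    = (2 * cos t * sin ((2 * real q + 1 + 1) * t) - sin ((2 * real q + 1) * t)) *\<^sub>R root i
      + sin ((2 * real q + 2) * t) *\<^sub>R root j"
    by (simp add: reflection_root g algebra_simps)
  also have "2 * cos t * sin ((2 * real q + 1 + 1) * t) - sin ((2 * real q + 1) * t)
     = sin ((2 * real q + 1 + 2) * t)" by (rule sin_step)
  finally show ?case by (simp add: algebra_simps)
qed (simp add: t_def)

lemma linear_funpow_rotation: "linear ((reflection i \<circ> reflection j) ^^ q)"
  by (induction q)
     (auto simp: linear_ident id_def intro!: linear_compose linear_reflection simp del: o_apply)

lemma rotation_order_root:
  assumes "i \<noteq> j"
  shows "((reflection i \<circ> reflection j) ^^ M i j) (root i) = root i"
proof -
  let ?t = "pi / M i j"
  have M: "M i j > 0" using off_diag[OF assms] by simp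
  have "sin ((2 * real (M i j) + 1) * ?t) = sin (2 * pi + ?t)" "sin (2 * real (M i j) * ?t) = 0"
    using M by (simp_all add: field_simps)
  then have "sin ?t *\<^sub>R ((reflection i \<circ> reflection j) ^^ M i j) (root i) = sin ?t *\<^sub>R root i"
    using funpow_rotation_root[OF assms, of "M i j"] by (simp add: sin_add)
  then show ?thesis using angle[OF assms] by simp
qed

lemma funpow_reverse:
  fixes f g :: "'a \<Rightarrow> 'a"
  assumes "\<And>x. f (g x) = x"
  shows "(f ^^ q) ((g ^^ q) x) = x"
proof (induction q arbitrary: x)
  case (Suc q)
  have "(f ^^ Suc q) ((g ^^ Suc q) x) = (f ^^ q) (f (g ((g ^^ q) x)))"
    by (simp add: funpow_swap1)
  then show ?case by (simp add: assms Suc)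
qed simp

text \<open>Since \<open>gram i j ^ 2 < 1\<close>, the form is nondegenerate on the plane of two
  distinct roots, so the space is the sum of that plane and its orthogonal complement, which both
  reflections fix.\<close>

lemma rotation_order: "(reflection i \<circ> reflection j) ^^ M i j = id"
proof (cases "i = j")
  case True
  then show ?thesis by (simp add: diag fun_eq_iff)
next
  case False
  let ?r = "reflection i \<circ> reflection j" and ?r' = "reflection j \<circ> reflection i"
  let ?T = "?r ^^ M i j"
  have j: "?T (root j) = root j"
  proof -
    have "?T ((?r' ^^ M i j) (root j)) = root j"
      by (rule funpow_reverse) simp
    moreover have "(?r' ^^ M i j) (root j) = root j"
      using rotation_order_root[of j i] False M_sym by simp
    ultimately show ?thesis by simp
  qed
  have fixed: "?T u = u" if "pairing i u = 0" "pairing j u = 0" for u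
  proof -
    have "?r u = u" using that by (simp add: reflection_def)
    then have "(?r ^^ q) u = u" for q by (induction q) auto
    then show ?thesis .
  qed
  show ?thesis
  proof
    fix v
    define g d P Q where "g = gram i j" and "d = 1 - g\<^sup>2"
      and "P = pairing i v" and "Q = pairing j v"
    \<comment> \<open>\<open>a\<close> and \<open>b\<close> solve the two-by-two Gram system of
      determinant \<open>d\<close>, which leaves \<open>u\<close> orthogonal to both roots.\<close>
    define a b u where "a = (P - g * Q) / d" and "b = (Q - g * P) / d"
      and "u = v - a *\<^sub>R root i - b *\<^sub>R root j"
    have d: "d \<noteq> 0" using angle[OF False] by (simp add: d_def g_def)
    have "a + g * b = ((P - g * Q) + g * (Q - g * P)) / d"
      by (simp add: a_def b_def add_divide_distrib)
    also have "(P - g * Q) + g * (Q - g * P) = P * d"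
      by (simp add: d_def algebra_simps power2_eq_square)
    finally have 1: "a + g * b = P" using d by simp
    have "b + g * a = ((Q - g * P) + g * (P - g * Q)) / d"
      by (simp add: a_def b_def add_divide_distrib)
    also have "(Q - g * P) + g * (P - g * Q) = Q * d"
      by (simp add: d_def algebra_simps power2_eq_square)
    finally have 2: "b + g * a = Q" using d by simp
    have "pairing i u = P - (a + g * b)" "pairing j u = Q - (b + g * a)"
      by (simp_all add: u_def g_def P_def Q_def gram_sym[of j i])
    then have "pairing i u = 0" "pairing j u = 0" by (simp_all add: 1 2)
    then have "?T u = u" by (rule fixed)
    moreover have "v = u + a *\<^sub>R root i + b *\<^sub>R root j" by (simp add: u_def)
    ultimately show "?T v = id v"
      using rotation_order_root[OF False] j
      by (simp add: linear_add[OF linear_funpow_rotation] linear_scale[OF linear_funpow_rotation])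
  qed
qed

section \<open>Words modulo the Coxeter relations\<close>

inductive cox_eq :: "'n list \<Rightarrow> 'n list \<Rightarrow> bool" (infix "\<approx>\<^sub>M" 50) where
  refl [simp]: "w \<approx>\<^sub>M w"
| sym: "v \<approx>\<^sub>M w \<Longrightarrow> w \<approx>\<^sub>M v"
| trans [trans]: "u \<approx>\<^sub>M v \<Longrightarrow> v \<approx>\<^sub>M w \<Longrightarrow> u \<approx>\<^sub>M w"
| relation: "u @ concat (replicate (M i j) [i, j]) @ v \<approx>\<^sub>M u @ v"

lemma cox_eq_context: "v \<approx>\<^sub>M w \<Longrightarrow> p @ v @ q \<approx>\<^sub>M p @ w @ q"
proof (induction rule: cox_eq.induct)
  case (relation u i j v)
  then show ?case using cox_eq.relation[of "p @ u" i j "v @ q"] by simp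
qed (auto intro: cox_eq.sym cox_eq.trans)

lemma cox_eq_append: "v \<approx>\<^sub>M v' \<Longrightarrow> w \<approx>\<^sub>M w' \<Longrightarrow> v @ w \<approx>\<^sub>M v' @ w'"
  using cox_eq_context[of v v' "[]" w] cox_eq_context[of w w' v' "[]"]
  by (auto intro: cox_eq.trans)

text \<open>The diagonal relation has exponent 1, so every letter is an involution and words need no
  inverse letters.\<close>

lemma cox_eq_cancel: "u @ [i, i] @ v \<approx>\<^sub>M u @ v"
  using relation[of u i i v] by (simp add: diag)

lemma cox_eq_rev: "w @ rev w \<approx>\<^sub>M []"
proof (induction w)
  case (Cons i w)
  have "[i] @ (w @ rev w) @ [i] \<approx>\<^sub>M [i] @ [] @ [i]"
    using Cons by (rule cox_eq_context)
  also have "[i] @ [] @ [i] \<approx>\<^sub>M []"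
    using cox_eq_cancel[of "[]" i "[]"] by simp
  finally show ?case by simp
qed simp

lemma act_concat_replicate: "act (concat (replicate q w)) = act w ^^ q"
  by (induction q) (auto simp: act_append)

lemma act_respects: "v \<approx>\<^sub>M w \<Longrightarrow> act v = act w"
proof (induction rule: cox_eq.induct)
  case (relation u i j v)
  then show ?case using rotation_order[of i j]
    by (simp add: act_append act_concat_replicate)
qed auto

text \<open>The alternating word of length \<open>p\<close> whose last letter is \<open>j\<close>.\<close>

primrec alt :: "nat \<Rightarrow> 'n \<Rightarrow> 'n \<Rightarrow> 'n list" where
  "alt 0 i j = []"
| "alt (Suc p) i j = (if even p then j else i) # alt p i j"

lemma length_alt [simp]: "length (alt p i j) = p"
  by (induction p) auto

lemma alt_snoc: "alt (Suc p) i j = alt p j i @ [j]"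
  by (induction p) auto

lemma alt_add: "\<exists>u. alt (q + p) i j = u @ alt p i j"
  by (induction q) auto

text \<open>The letters that meet at the junction differ, so the alternation continues through all
  \<open>2 * q\<close> letters.\<close>

lemma rev_alt_alt: "rev (alt q j i) @ alt q i j = concat (replicate q [i, j])"
proof (induction q arbitrary: i j)
  case (Suc q)
  have "rev (alt (Suc q) j i) @ alt (Suc q) i j = i # concat (replicate q [j, i]) @ [j]"
    using Suc[of i j] by (simp add: alt_snoc del: alt.simps)
  also have "\<dots> = concat (replicate (Suc q) [i, j])"
    by (induction q) auto
  finally show ?case .
qed simp

lemma braid: "alt (M i j) i j \<approx>\<^sub>M alt (M i j) j i"
proof -
  let ?a = "alt (M i j) i j" and ?b = "alt (M i j) j i"
  have "(?b @ rev ?b) @ ?a \<approx>\<^sub>M [] @ ?a"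
    by (rule cox_eq_append) (auto intro: cox_eq_rev)
  then have "?a \<approx>\<^sub>M ?b @ concat (replicate (M i j) [i, j]) @ []"
    by (simp add: rev_alt_alt cox_eq.sym)
  also have "\<dots> \<approx>\<^sub>M ?b @ []" by (rule relation)
  finally show ?thesis by simp
qed

text \<open>Prepending a letter changes only the coefficient of its own root, by
  \<open>sin_step\<close>. For \<open>p < M i j\<close> both coefficients are nonnegative; at
  \<open>p = M i j\<close> the second one vanishes.\<close>

lemma act_alt_root:
  assumes "i \<noteq> j"
  defines "t \<equiv> pi / M i j"
  shows "sin t *\<^sub>R act (alt p i j) (root i) =
    sin ((real p + 1) * t) *\<^sub>R root (if even p then i else j)
      + sin (real p * t) *\<^sub>R root (if even p then j else i)"
proof (induction p)
  case (Suc p)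
  define a where "a = (if even p then j else i)"
  define b where "b = (if even p then i else j)"
  have g: "gram a b = - cos t"
    using M_sym[of i j] by (auto simp: a_def b_def gram_def t_def)
  have "sin t *\<^sub>R act (alt (Suc p) i j) (root i) = reflection a (sin t *\<^sub>R act (alt p i j) (root i))"
    by (simp add: a_def)
  also have "\<dots> = reflection a (sin ((real p + 1) * t) *\<^sub>R root b + sin (real p * t) *\<^sub>R root a)"
    using Suc by (simp only: a_def b_def)
  also have "\<dots> = (2 * cos t * sin ((real p + 1) * t) - sin (real p * t)) *\<^sub>R root a
      + sin ((real p + 1) * t) *\<^sub>R root b"
    by (simp add: reflection_root g algebra_simps)
  also note sin_step
  finally show ?case by (simp add: a_def b_def algebra_simps)
qed simp

section \<open>Coxeter length and Tits' positivity argument\<close>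

definition len :: "'n list \<Rightarrow> nat" where
  "len w = (LEAST l. \<exists>u. u \<approx>\<^sub>M w \<and> length u = l)"

lemma len_le: "u \<approx>\<^sub>M w \<Longrightarrow> len w \<le> length u"
  unfolding len_def by (rule Least_le) auto

lemma reduced_word: obtains u where "u \<approx>\<^sub>M w" "length u = len w"
proof -
  have "\<exists>u. u \<approx>\<^sub>M w \<and> length u = len w"
    unfolding len_def by (rule LeastI_ex) (auto intro: cox_eq.refl)
  then show ?thesis using that by blast
qed

lemma len_cong: "v \<approx>\<^sub>M w \<Longrightarrow> len v = len w"
  by (metis reduced_word len_le cox_eq.trans cox_eq.sym le_antisym)

lemma len_append_le: "len (u @ v) \<le> len u + length v"
proof -
  obtain u' where "u' \<approx>\<^sub>M u" "length u' = len u" by (rule reduced_word)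
  then show ?thesis using len_le[of "u' @ v" "u @ v"] cox_eq_append[of u' u v v] by simp
qed

lemma cox_eq_snoc_snoc: "w @ [j] @ [j] \<approx>\<^sub>M w"
  using cox_eq_cancel[of w j "[]"] by simp

text \<open>The last letter of a shortest word for \<open>w\<close> is a descent, because cancelling
  it leaves a shorter word.\<close>

lemma right_descent:
  assumes "\<not> w \<approx>\<^sub>M []"
  obtains j where "len (w @ [j]) < len w"
proof -
  obtain u where u: "u \<approx>\<^sub>M w" "length u = len w" by (rule reduced_word)
  with assms have "u \<noteq> []" by (auto dest: cox_eq.sym)
  then obtain u' j where u': "u = u' @ [j]" by (metis rev_exhaust)
  have "u' \<approx>\<^sub>M u' @ [j] @ [j]" using cox_eq_snoc_snoc by (rule cox_eq.sym)
  also have "u' @ [j] @ [j] \<approx>\<^sub>M w @ [j]"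
    using cox_eq_append[OF u(1), of "[j]" "[j]"] u' by simp
  finally have "len (w @ [j]) \<le> length u'" by (rule len_le)
  also have "length u' < len w" using u(2) u' by simp
  finally show ?thesis by (rule that)
qed

definition nonneg :: "real^'n \<Rightarrow> bool" where
  "nonneg v \<longleftrightarrow> (\<forall>i. 0 \<le> v $ i)"

text \<open>Tits' argument: strip from the right of \<open>w\<close> a maximal alternating word in \<open>i\<close> and a descent
  \<open>j\<close>. Neither \<open>i\<close> nor \<open>j\<close> is a descent of the rest, so induction applies to it, and the claim is
  reduced to the dihedral case, which is the sine formula \<open>act_alt_root\<close>.\<close>

lemma act_root_nonneg:
  assumes "len w \<le> len (w @ [i])"
  shows "nonneg (act w (root i))"
  using assms
proof (induction "len w" arbitrary: w i rule: less_induct)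
  case less
  show ?case
  proof (cases "w \<approx>\<^sub>M []")
    case True
    then show ?thesis using act_respects[OF True] by (simp add: nonneg_def axis_def)
  next
    case False
    then obtain j where j: "len (w @ [j]) < len w" by (rule right_descent)
    with less.prems have ij: "i \<noteq> j" by auto
    \<comment> \<open>\<open>P p\<close> says that an alternating word of \<open>p\<close> letters
      ending in \<open>j\<close> splits off \<open>w\<close> with lengths adding up;
      \<open>P 1\<close> comes from the descent \<open>j\<close>.\<close>
    define P where "P p \<longleftrightarrow> (\<exists>v. w \<approx>\<^sub>M v @ alt p i j \<and> len v + p = len w)" for p
    have P_le: "p \<le> len w" if "P p" for p using that by (auto simp: P_def)
    have P1: "P 1"
    proof -
      have "w \<approx>\<^sub>M (w @ [j]) @ alt 1 i j"
        using cox_eq_snoc_snoc[THEN cox_eq.sym] by simp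
      moreover have "len w \<le> len (w @ [j]) + 1"
        using len_append_le[of "w @ [j]" "[j]"] len_cong[OF cox_eq_snoc_snoc[of w j]] by simp
      ultimately show ?thesis using j unfolding P_def by (intro exI[of _ "w @ [j]"]) auto
    qed
    define p where "p = (GREATEST p. P p)"
    have Pp: "P p" unfolding p_def using P1 P_le by (rule GreatestI_nat)
    have p_max: "q \<le> p" if "P q" for q unfolding p_def using that P_le by (rule Greatest_le_nat)
    have "p \<ge> 1" using P1 by (rule p_max)
    then obtain p' where p': "p = Suc p'" by (cases p) auto
    obtain v where v: "w \<approx>\<^sub>M v @ alt p i j" "len v + p = len w" using Pp by (auto simp: P_def)
    have short: "len w \<le> len (v @ u) + length z" if "alt p i j = u @ z" for u z
      using len_append_le[of "v @ u" z] len_cong[OF v(1)] that by simp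
    \<comment> \<open>This letter opens \<open>alt p i j\<close>. If it shortened \<open>v\<close>,
      moving it across would give a word for \<open>w\<close> shorter than
      \<open>len w\<close>.\<close>
    have asc1: "len v \<le> len (v @ [if even p' then j else i])"
      using short[of "[if even p' then j else i]" "alt p' i j"] v(2) p' by simp
    \<comment> \<open>If the other letter shortened \<open>v\<close>, it would extend the
      alternating word to length \<open>p + 1\<close>, against maximality.\<close>
    have asc2: "len v \<le> len (v @ [if even p then j else i])"
    proof (rule ccontr)
      define a where "a = (if even p then j else i)"
      assume "\<not> len v \<le> len (v @ [if even p then j else i])"
      then have less: "len (v @ [a]) < len v" by (simp add: a_def)
      have "v @ alt p i j \<approx>\<^sub>M ((v @ [a]) @ [a]) @ alt p i j"
        using cox_eq_snoc_snoc by (intro cox_eq_append) (auto intro: cox_eq.sym)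
      with v(1) have "w \<approx>\<^sub>M (v @ [a]) @ alt (Suc p) i j"
        by (auto simp: a_def intro: cox_eq.trans)
      moreover have "len v \<le> len (v @ [a]) + 1"
        using len_append_le[of "v @ [a]" "[a]"] len_cong[OF cox_eq_snoc_snoc[of v a]] by simp
      ultimately have "P (Suc p)"
        using less v(2) unfolding P_def by (intro exI[of _ "v @ [a]"]) auto
      then show False using p_max by fastforce
    qed
    have "len v \<le> len (v @ [i])" "len v \<le> len (v @ [j])"
      using asc1 asc2 p' by (auto split: if_splits)
    then have pos: "nonneg (act v (root i))" "nonneg (act v (root j))"
      using less.hyps[of v] v(2) p' by auto
    \<comment> \<open>Otherwise the braid relation makes \<open>w\<close> end in \<open>i\<close>,
      which cancels against the appended \<open>i\<close>, and \<open>i\<close> is a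
      descent.\<close>
    have pM: "p < M i j"
    proof (rule ccontr)
      assume "\<not> p < M i j"
      then obtain q where q: "p = q + M i j" by (metis add.commute le_add_diff_inverse not_less)
      then obtain u where u: "alt p i j = u @ alt (M i j) i j" using alt_add by metis
      obtain r where r: "M i j = Suc r" using off_diag[OF ij] by (cases "M i j") auto
      have "w @ [i] \<approx>\<^sub>M (v @ u @ alt (M i j) i j) @ [i]"
        using v(1) u by (intro cox_eq_append) auto
      also have "\<dots> \<approx>\<^sub>M (v @ u @ alt (M i j) j i) @ [i]"
        by (intro cox_eq_append braid cox_eq.refl)
      also have "\<dots> = (v @ u @ alt r i j) @ [i] @ [i]"
        by (simp add: r alt_snoc del: alt.simps)
      also have "\<dots> \<approx>\<^sub>M v @ u @ alt r i j" by (rule cox_eq_snoc_snoc)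
      finally have "len (w @ [i]) = len (v @ u @ alt r i j)" by (rule len_cong)
      also have "\<dots> \<le> len v + (length u + r)" using len_append_le[of v "u @ alt r i j"] by simp
      also have "length u + r < p" using arg_cong[OF u, of length] r by simp
      finally show False using less.prems v(2) by simp
    qed
    let ?t = "pi / M i j"
    have s: "sin ?t > 0" using angle[OF ij] by simp
    have "sin (x * ?t) \<ge> 0" if "0 \<le> x" "x \<le> real (M i j)" for x
      using that pM by (intro sin_ge_zero) (auto simp: field_simps)
    from this[of "real p"] this[of "real p + 1"] pM
    have sp: "sin (real p * ?t) \<ge> 0" "sin ((real p + 1) * ?t) \<ge> 0" by auto
    have "sin ?t *\<^sub>R act w (root i) = act v (sin ?t *\<^sub>R act (alt p i j) (root i))"
      using act_respects[OF v(1)] by (simp add: act_append)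
    also have "\<dots> = sin ((real p + 1) * ?t) *\<^sub>R act v (root (if even p then i else j))
      + sin (real p * ?t) *\<^sub>R act v (root (if even p then j else i))"
      by (simp only: act_alt_root[OF ij] act_simps)
    finally have w: "sin ?t *\<^sub>R act w (root i) =
      sin ((real p + 1) * ?t) *\<^sub>R act v (root (if even p then i else j))
      + sin (real p * ?t) *\<^sub>R act v (root (if even p then j else i))" .
    have "0 \<le> sin ?t * (act w (root i) $ l)" for l
    proof -
      have "sin ?t * (act w (root i) $ l) = (sin ?t *\<^sub>R act w (root i)) $ l" by simp
      also have "\<dots> = sin ((real p + 1) * ?t) * (act v (root (if even p then i else j)) $ l)
          + sin (real p * ?t) * (act v (root (if even p then j else i)) $ l)"
        by (simp only: w vector_add_component vector_scaleR_component real_scaleR_def)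
      also have "0 \<le> \<dots>"
        using sp pos unfolding nonneg_def by (intro add_nonneg_nonneg mult_nonneg_nonneg) auto
      finally show ?thesis .
    qed
    then show ?thesis using s by (simp add: nonneg_def zero_le_mult_iff)
  qed
qed

text \<open>A descent \<open>j\<close> of a nontrivial \<open>w\<close> forces
  \<open>act w (root j)\<close> to be nonpositive, hence 0, which an invertible map excludes.
  Assuming only nonnegativity allows for rescaled and permuted roots.\<close>

theorem act_faithful:
  assumes "\<And>i. nonneg (act w (root i))"
  shows "w \<approx>\<^sub>M []"
proof (rule ccontr)
  assume "\<not> w \<approx>\<^sub>M []"
  then obtain j where j: "len (w @ [j]) < len w" by (rule right_descent)
  have "len ((w @ [j]) @ [j]) = len w" using len_cong[OF cox_eq_snoc_snoc[of w j]] by simp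
  then have "nonneg (act (w @ [j]) (root j))" using j by (intro act_root_nonneg) simp
  then have "nonneg (- act w (root j))" by (simp add: act_append)
  with assms[of j] have "act w (root j) = 0"
    by (auto simp: nonneg_def vec_eq_iff intro: antisym)
  then have "root j = act (rev w) (0 *\<^sub>R root j)"
    using act_rev_act[of w "root j"] by (simp del: act_rev_act)
  also have "\<dots> = 0" by (subst act_simps(4)) simp
  finally have "root j $ j = 0" by simp
  then show False by simp
qed

end

subsection \<open>Central elements of triangle groups\<close>

context coxeter_matrix
begin

lemma gram_ne_0:
  assumes "2 < M i j"
  shows "gram i j \<noteq> 0"
proof -
  have "pi / M i j < pi / 2"
    using assms by (intro divide_strict_left_mono) auto
  then have "cos (pi / M i j) > 0" using assms by (intro cos_gt_zero) auto
  then show ?thesis by (simp add: gram_def)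
qed

text \<open>A linear coordinate that is invariant under the rotation \<open>s\<^sub>i s\<^sub>j\<close> vanishes on the
  roots \<open>i\<close> and \<open>j\<close>; the coordinate \<open>l\<close> of \<open>act w\<close> is of this kind.\<close>

lemma commuting_component_eq_0:
  assumes "i \<noteq> j" "l \<noteq> i" "l \<noteq> j"
    and comm: "\<And>v. act w (reflection i (reflection j v)) = reflection i (reflection j (act w v))"
  shows "act w (root i) $ l = 0" "act w (root j) $ l = 0"
proof -
  define f where "f v = act w v $ l" for v
  have f: "f (u + v) = f u + f v" "f (u - v) = f u - f v" "f (- v) = - f v" "f (c *\<^sub>R v) = c * f v" for u v c
    by (simp_all add: f_def)
  define g where "g = gram i j"
  \<comment> \<open>The two reflections alter only the coordinates \<open>i\<close> and
    \<open>j\<close>, not \<open>l\<close>.\<close>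
  have inv: "f (reflection i (reflection j v)) = f v" for v
    using assms by (simp add: f_def comm) (simp add: reflection_def axis_def)
  have "f (reflection i (reflection j (root j))) = 2 * g * f (root i) - f (root j)"
    by (simp add: reflection_root f g_def)
  then have 1: "f (root j) = g * f (root i)" using inv[of "root j"] by simp
  have "f (reflection i (reflection j (root i))) =
      - f (root i) - 2 * g * f (root j) + 4 * g * g * f (root i)"
    by (simp add: reflection_root f g_def gram_sym[of j i] algebra_simps)
  then have "2 * f (root i) * (1 - g\<^sup>2) = 0"
    using inv[of "root i"] 1 by (simp add: algebra_simps power2_eq_square)
  then have "f (root i) = 0" using angle[OF assms(1)] by (simp add: g_def)
  with 1 show "act w (root i) $ l = 0" "act w (root j) $ l = 0" by (simp_all add: f_def)
qed

text \<open>Coordinate \<open>i\<close> of the rotated \<open>root j\<close> is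
  \<open>2 * gram i j\<close>, nonzero; the two orders of composition scale it by \<open>a\<close>
  and by \<open>b\<close>.\<close>

lemma commuting_eigenvalues_eq:
  assumes "i \<noteq> j" "gram i j \<noteq> 0" "act w (root i) = a *\<^sub>R root i" "act w (root j) = b *\<^sub>R root j"
    and comm: "\<And>v. act w (reflection i (reflection j v)) = reflection i (reflection j (act w v))"
  shows "a = b"
proof -
  have "act w (reflection i (reflection j (root j))) $ i = 2 * gram i j * a"
    using assms by (simp add: reflection_root) (simp add: axis_def)
  moreover have "reflection i (reflection j (act w (root j))) $ i = 2 * gram i j * b"
    using assms by (simp add: reflection_root) (simp add: axis_def)
  ultimately show ?thesis using assms(2) by (simp only: comm) simp
qed

end

section \<open>Rank three\<close>

locale triangle_matrix = coxeter_matrix M for M :: "3 \<Rightarrow> 3 \<Rightarrow> nat"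
begin

lemma det_reflection: "det (matrix (reflection i)) = - 1"
proof -
  have "matrix (reflection i) $ k $ l = (if k = l then 1 else 0) - 2 * gram i l * (if k = i then 1 else 0)" for k l
    by (simp add: matrix_def reflection_root) (simp add: axis_def)
  then show ?thesis
    using exhaust_3[of i] by (auto simp: det_3)
qed

lemma det_act: "det (matrix (act w)) = (- 1) ^ length w"
proof (induction w)
  case Nil
  then show ?case by (simp only: act_Nil matrix_id_mat_1 det_I) simp
next
  case (Cons i w)
  then show ?case
    by (simp add: matrix_compose[OF linear_act linear_reflection] det_mul det_reflection del: o_apply)
qed

text \<open>The roots 1 and 3 are not orthogonal, so they share an eigenvalue; determinant 1 then
  makes the eigenvalue of root 2 positive. The disjunction on \<open>M\<close> excludes a negative
  shared eigenvalue.\<close>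

theorem commuting_trivial:
  assumes even: "even (length w)"
    and c12: "\<And>v. act w (reflection 1 (reflection 2 v)) = reflection 1 (reflection 2 (act w v))"
    and c32: "\<And>v. act w (reflection 3 (reflection 2 v)) = reflection 3 (reflection 2 (act w v))"
    and M13: "2 < M 1 3" and M: "2 < M 1 2 \<or> 2 < M 3 2 \<or> odd (M 1 3)"
  shows "w \<approx>\<^sub>M []"
proof -
  \<comment> \<open>Commuting with a rotation gives commuting with its inverse; composing with
    \<open>c12\<close> then handles the pair 1, 3.\<close>
  have c23: "act w (reflection 2 (reflection 3 v)) = reflection 2 (reflection 3 (act w v))" for v
    using c32[of "reflection 2 (reflection 3 v)"] by simp
  have c13: "act w (reflection 1 (reflection 3 v)) = reflection 1 (reflection 3 (act w v))" for v
    using c12[of "reflection 2 (reflection 3 v)"] by (simp add: c23)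
  have ne: "(1::3) \<noteq> 2" "(1::3) \<noteq> 3" "(2::3) \<noteq> 3" "(2::3) \<noteq> 1" "(3::3) \<noteq> 1" "(3::3) \<noteq> 2"
    by simp_all
  define a where "a i = act w (root i) $ i" for i
  \<comment> \<open>Each of the three rotations kills the coordinate outside its plane; together
    they kill all off-diagonal entries.\<close>
  have "act w (root i) $ l = 0" if "i \<noteq> l" for i l
    using that exhaust_3[of i] exhaust_3[of l]
      commuting_component_eq_0[OF ne(1,5,6) c12] commuting_component_eq_0[OF ne(2,4,3) c13]
      commuting_component_eq_0[OF ne(6,2,1) c32]
    by auto
  then have a: "act w (root i) = a i *\<^sub>R root i" for i
    by (auto simp: vec_eq_iff a_def axis_def)
  have a13: "a 1 = a 3"
    using ne(2) gram_ne_0[OF M13] a a c13 by (rule commuting_eigenvalues_eq)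
  have "det (matrix (act w)) = a 1 * a 2 * a 3"
    by (simp add: det_3 matrix_def a) (simp add: axis_def)
  then have det: "a 1 * a 2 * a 3 = 1" using even by (simp add: det_act)
  show ?thesis
  proof (cases "a 1 > 0")
    case True
    with det a13 have "a 2 > 0" by (metis mult.commute mult_pos_pos zero_less_mult_pos zero_less_one)
    with True a13 have "a i > 0" for i using exhaust_3[of i] by auto
    then have "nonneg (act w (root i))" for i
      by (simp only: a nonneg_def) (simp add: axis_def less_imp_le)
    then show ?thesis by (rule act_faithful)
  next
    case False
    with det have a1: "a 1 < 0" by (cases "a 1 = 0") auto
    have "a 2 * (a 1)\<^sup>2 = 1" using det a13 by (simp add: power2_eq_square mult_ac)
    then have a2: "a 2 > 0"
      by (metis zero_le_power2 zero_less_one zero_less_mult_iff not_less)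
    \<comment> \<open>Root 2 has an eigenvalue of the other sign than roots 1 and 3, so it must be
      orthogonal to both.\<close>
    have "\<not> 2 < M 1 2" "\<not> 2 < M 3 2"
      using commuting_eigenvalues_eq[OF ne(1) gram_ne_0 a a c12] commuting_eigenvalues_eq[OF ne(6) gram_ne_0 a a c32]
        a1 a2 a13 by auto
    with M have "M 1 2 = 2" "M 3 2 = 2" and odd: "odd (M 1 3)"
      using off_diag[of 1 2] off_diag[of 3 2] ne by auto
    then have g: "gram 1 2 = 0" "gram 3 2 = 0" by (simp_all add: gram_def)
    txt \<open>Now \<open>act w\<close> is negative on the roots 1 and 3, as is the longest word \<open>z\<close> in the letters 1 and 3.
      So \<open>w @ z\<close> is positive on all roots, although it interchanges the lines of 1 and 3.\<close>
    have longest: "act (alt (M i j) i j) (root i) = - root j"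
      if "i \<noteq> j" "odd (M i j)" for i j
    proof -
      have "M i j > 0" using off_diag[OF that(1)] by simp
      \<comment> \<open>At \<open>p = M i j\<close> the sine formula has the coefficients
        \<open>- sin (pi / M i j)\<close> and 0; odd \<open>p\<close> puts the first on
        \<open>root j\<close>.\<close>
      then have "sin ((real (M i j) + 1) * (pi / M i j)) = sin (pi + pi / M i j)"
        and "sin (real (M i j) * (pi / M i j)) = 0"
        by (simp_all add: field_simps)
      then have "sin (pi / M i j) *\<^sub>R act (alt (M i j) i j) (root i) = sin (pi / M i j) *\<^sub>R (- root j)"
        using act_alt_root[OF that(1), of "M i j"] that(2) by simp
      then show ?thesis using angle[OF that(1)] by (simp del: scaleR_minus_right)
    qed
    define z where "z = alt (M 1 3) 1 3"
    have z1: "act z (root 1) = - root 3"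
      using longest[OF ne(2) odd] by (simp add: z_def)
    have z3: "act z (root 3) = - root 1"
      using longest[OF ne(5)] odd act_respects[OF braid[of 1 3]] by (simp add: z_def M_sym[of 3 1])
    have "act (alt p 1 3) (root 2) = root 2" for p
      by (induction p) (simp_all add: reflection_root g)
    then have z2: "act z (root 2) = root 2" by (simp add: z_def)
    have "act (w @ z) (root 1) = (- a 3) *\<^sub>R root 3"
      and "act (w @ z) (root 2) = a 2 *\<^sub>R root 2"
      and "act (w @ z) (root 3) = (- a 1) *\<^sub>R root 1"
      by (simp_all add: act_append z1 z2 z3 a)
    moreover have "nonneg (c *\<^sub>R root i)" if "0 < c" for c i
      using that by (simp add: nonneg_def axis_def)
    ultimately have "nonneg (act (w @ z) (root i))" for i
      using exhaust_3[of i] a1 a2 a13 by (auto simp del: scaleR_minus_left)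
    then have "w @ z \<approx>\<^sub>M []" by (rule act_faithful)
    then have "act (w @ z) (root 1) = root 1" by (simp add: act_respects)
    then have "(- a 3 *\<^sub>R root 3) $ 1 = (root 1 :: real^3) $ 1" by (simp add: act_append z1 a)
    then show ?thesis by (simp add: axis_def)
  qed
qed

end

section \<open>Values of Coxeter words in a group\<close>

context group
begin

text \<open>For \<open>b i = r\<^sub>i t\<close>, with involutions \<open>r\<^sub>i\<close> and \<open>t\<close> in a bigger group, the value at an even word
  is the product of its letters \<open>r\<^sub>i\<close>. The Boolean is the parity of the position.\<close>

primrec alternating_prod :: "('i \<Rightarrow> 'a) \<Rightarrow> bool \<Rightarrow> 'i list \<Rightarrow> 'a" where
  "alternating_prod b e [] = \<one>"
| "alternating_prod b e (i # w) = (if e then b i else inv b i) \<otimes> alternating_prod b (\<not> e) w"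

lemma alternating_prod_closed:
  "range b \<subseteq> carrier G \<Longrightarrow> alternating_prod b e w \<in> carrier G"
  by (induction w arbitrary: e) (auto simp: image_subset_iff)

lemma alternating_prod_append:
  assumes "range b \<subseteq> carrier G"
  shows "alternating_prod b e (u @ w) =
    alternating_prod b e u \<otimes> alternating_prod b (e = even (length u)) w"
proof (induction u arbitrary: e)
  case (Cons i u)
  have "b i \<in> carrier G" using assms by auto
  then show ?case
    using Cons[of "\<not> e"] alternating_prod_closed[OF assms] by (cases e) (simp_all add: m_assoc)
qed (simp add: alternating_prod_closed[OF assms])

lemma alternating_prod_replicate:
  assumes "range b \<subseteq> carrier G"
  shows "alternating_prod b e (concat (replicate q [i, j])) = alternating_prod b e [i, j] [^] q"
proof (induction q)
  case (Suc q)
  have "alternating_prod b e (concat (replicate (Suc q) [i, j])) =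
      alternating_prod b e [i, j] \<otimes> alternating_prod b e (concat (replicate q [i, j]))"
    using alternating_prod_append[OF assms, of e "[i, j]"] by simp
  then show ?case
    using Suc alternating_prod_closed[OF assms, of e "[i, j]"] by (simp only: nat_pow_Suc2)
qed simp

text \<open>\<open>inv x \<otimes> y\<close> is conjugate to \<open>y \<otimes> inv x\<close>, the
  inverse of \<open>x \<otimes> inv y\<close>. This handles relators that start at a position of the
  other parity.\<close>

lemma inv_mult_pow_eq_one:
  assumes "x \<in> carrier G" "y \<in> carrier G" "(x \<otimes> inv y) [^] (q::nat) = \<one>"
  shows "(inv x \<otimes> y) [^] q = \<one>"
proof -
  have "(inv x \<otimes> y) [^] q = inv x \<otimes> (y \<otimes> inv x) [^] q \<otimes> x"
  proof (induction q)
    case (Suc q)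
    have "inv x \<otimes> (y \<otimes> inv x) [^] q \<otimes> x \<otimes> (inv x \<otimes> y) =
        inv x \<otimes> ((y \<otimes> inv x) [^] q \<otimes> (y \<otimes> inv x)) \<otimes> x"
      using assms by (simp add: m_assoc) (simp add: m_assoc[symmetric])
    then show ?case using Suc by simp
  qed (use assms in simp)
  also have "y \<otimes> inv x = inv (x \<otimes> inv y)" using assms by (simp add: inv_mult_group)
  also have "\<dots> [^] q = \<one>" using assms by (simp add: nat_pow_inv)
  finally show ?thesis using assms by simp
qed

end

text \<open>A relator has even length, so deleting it keeps the parity of all later positions, and
  its value is trivial at either parity. Words are thus evaluated without adjoining the involutions
  to \<open>G\<close>.\<close>

lemma (in coxeter_matrix) alternating_prod_respects:
  fixes G (structure)
  assumes "group G" and b: "range b \<subseteq> carrier G"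
    and rel: "\<And>i j. (b i \<otimes> inv b j) [^] M i j = \<one>"
    and "v \<approx>\<^sub>M w"
  shows "group.alternating_prod G b e v = group.alternating_prod G b e w"
proof -
  interpret group G by fact
  from \<open>v \<approx>\<^sub>M w\<close> show ?thesis
  proof (induction rule: cox_eq.induct)
    case (relation u i j v)
    have bi: "b i \<in> carrier G" for i using b by auto
    have one: "alternating_prod b e (concat (replicate (M i j) [i, j])) = \<one>" for e
      using rel[of i j] inv_mult_pow_eq_one[OF bi bi rel] bi
      by (simp add: alternating_prod_replicate[OF b])
    have "even (length (concat (replicate (M i j) [i, j])))"
      by (simp add: length_concat sum_list_replicate)
    then show ?case
      using alternating_prod_closed[OF b] by (simp add: alternating_prod_append[OF b] one)
  qed auto
qed

subsection \<open>Relations in toric reflection groups\<close>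

context group
begin

primrec seg :: "(nat \<Rightarrow> 'a) \<Rightarrow> nat \<Rightarrow> nat \<Rightarrow> 'a" where
  "seg x i 0 = \<one>"
| "seg x i (Suc l) = x i \<otimes> seg x (Suc i) l"

lemma seg_closed [simp]: "range x \<subseteq> carrier G \<Longrightarrow> seg x i l \<in> carrier G"
  by (induction l arbitrary: i) (auto simp: image_subset_iff)

lemma seg_cong: "(\<And>d. x (i + d) = x (j + d)) \<Longrightarrow> seg x i l = seg x j l"
proof (induction l arbitrary: i j)
  case (Suc l)
  have "x (Suc i + d) = x (Suc j + d)" for d using Suc.prems[of "Suc d"] by simp
  then have "seg x (Suc i) l = seg x (Suc j) l" by (rule Suc.IH)
  then show ?case using Suc.prems[of 0] by simp
qed simp

lemma seg_add:
  assumes "range x \<subseteq> carrier G"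
  shows "seg x i (l + q) = seg x i l \<otimes> seg x (i + l) q"
proof (induction l arbitrary: i)
  case (Suc l)
  have "x i \<in> carrier G" using assms by auto
  then show ?case using Suc[of "Suc i"] assms by (simp add: m_assoc)
qed (simp add: assms)

lemma seg_mult:
  assumes "range x \<subseteq> carrier G" "\<And>j. seg x (i + j * l) l = a"
  shows "seg x i (q * l) = a [^] q"
proof (induction q)
  case (Suc q)
  have "seg x i (Suc q * l) = seg x i (q * l) \<otimes> seg x (i + q * l) l"
    using seg_add[OF assms(1), of i "q * l" l] by (simp add: add.commute)
  then show ?case using Suc assms(2) by simp
qed simp

text \<open>Each factor is the previous one conjugated by \<open>Y\<close>, so inserting powers of
  \<open>Y\<close> makes the product telescope.\<close>

lemma seg_eq_pow:
  assumes x: "range x \<subseteq> carrier G" and Y: "Y \<in> carrier G"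
    and shift: "\<And>i. Y \<otimes> x (Suc i) = x i \<otimes> Y"
  shows "seg x i l = (x i \<otimes> inv Y) [^] l \<otimes> Y [^] l"
proof (induction l)
  case (Suc l)
  have xi: "x i \<in> carrier G" for i using x by auto
  have "Y \<otimes> seg x (Suc i) l = seg x i l \<otimes> Y" for i
  proof (induction l arbitrary: i)
    case (Suc l)
    have "Y \<otimes> seg x (Suc i) (Suc l) = x i \<otimes> (Y \<otimes> seg x (Suc (Suc i)) l)"
      using x Y xi shift[of i] by (simp add: m_assoc[symmetric])
    then show ?case using Suc x Y xi by (simp add: m_assoc)
  qed (use Y in simp)
  then have "seg x (Suc i) l = inv Y \<otimes> (seg x i l \<otimes> Y)"
    using x Y by (simp add: inv_solve_left)
  then have "seg x i (Suc l) = (x i \<otimes> inv Y) \<otimes> (x i \<otimes> inv Y) [^] l \<otimes> (Y [^] l \<otimes> Y)"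
    using Suc Y xi by (simp add: m_assoc)
  also have "(x i \<otimes> inv Y) \<otimes> (x i \<otimes> inv Y) [^] l = (x i \<otimes> inv Y) [^] Suc l"
    using Y xi by (simp only: nat_pow_Suc2 m_closed inv_closed)
  finally show ?case by simp
qed simp

lemma subgroup_centralizer:
  assumes a: "a \<in> carrier G"
  shows "subgroup {g \<in> carrier G. a \<otimes> g = g \<otimes> a} G"
proof (rule subgroupI)
  show "{g \<in> carrier G. a \<otimes> g = g \<otimes> a} \<noteq> {}" using a by auto
next
  fix g assume g: "g \<in> {g \<in> carrier G. a \<otimes> g = g \<otimes> a}"
  then have "g \<in> carrier G" by simp
  then have "inv g \<otimes> a = inv g \<otimes> (a \<otimes> g) \<otimes> inv g"
    using a by (simp add: m_assoc)
  also have "a \<otimes> g = g \<otimes> a" using g by simp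
  also have "inv g \<otimes> (g \<otimes> a) \<otimes> inv g = a \<otimes> inv g"
    using a g by (simp add: m_assoc[symmetric])
  finally show "inv g \<in> {g \<in> carrier G. a \<otimes> g = g \<otimes> a}" using g by simp
next
  fix g h assume gh: "g \<in> {g \<in> carrier G. a \<otimes> g = g \<otimes> a}" "h \<in> {g \<in> carrier G. a \<otimes> g = g \<otimes> a}"
  then have car: "g \<in> carrier G" "h \<in> carrier G" and comm: "a \<otimes> g = g \<otimes> a" "a \<otimes> h = h \<otimes> a"
    by auto
  have "a \<otimes> (g \<otimes> h) = a \<otimes> g \<otimes> h" using a car by (simp add: m_assoc)
  also have "\<dots> = g \<otimes> (a \<otimes> h)" using a car by (simp add: comm(1) m_assoc)
  also have "\<dots> = g \<otimes> h \<otimes> a" using a car by (simp add: comm(2) m_assoc)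
  finally show "g \<otimes> h \<in> {g \<in> carrier G. a \<otimes> g = g \<otimes> a}" using gh by simp
qed auto

lemma pow_conj:
  assumes "a \<in> carrier G" "b \<in> carrier G"
  shows "(inv a \<otimes> b \<otimes> a) [^] (q::nat) = inv a \<otimes> b [^] q \<otimes> a"
proof (induction q)
  case (Suc q)
  then show ?case using assms by (simp add: m_assoc) (simp add: m_assoc[symmetric])
qed (use assms in simp)

lemma gword_eval_toric_word:
  "gword_eval G f (toric_word n i l) = seg (\<lambda>j. f (j mod n)) i l"
proof (induction l arbitrary: i)
  case (Suc l)
  have "toric_word n i (Suc l) = (i mod n, True) # toric_word n (Suc i) l"
    by (simp add: toric_word_def upt_conv_Cons del: upt_Suc)
  then show ?case using Suc by simp
qed (simp add: toric_word_def)

lemma gword_eval_replicate: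
  assumes "f x \<in> carrier G"
  shows "gword_eval G f (replicate q (x, True)) = f x [^] q"
proof (induction q)
  case (Suc q)
  have "f x [^] Suc q = f x \<otimes> f x [^] q" using assms by (rule nat_pow_Suc2)
  then show ?case using Suc by simp
qed simp

text \<open>The conjugates of \<open>B\<close> by powers of \<open>A\<close> serve as generators. By
  telescoping, \<open>m\<close> consecutive ones multiply to a conjugate of
  \<open>(B \<otimes> inv A) [^] m\<close> times \<open>A [^] m\<close>, which does not depend on
  the starting index.\<close>

lemma toric_hom:
  assumes A: "A \<in> carrier G" "A [^] n = \<one>" and B: "B \<in> carrier G" "B [^] k = \<one>"
    and BA: "(B \<otimes> inv A) [^] m = \<one>" and "0 < n"
  obtains h where "h \<in> hom (toric_reflection_group k n m) G"
    and "\<And>j. h (toric_gen k n m j) = inv (A [^] j) \<otimes> B \<otimes> A [^] j"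
    and "\<And>i. seg (\<lambda>j. h (toric_gen k n m j)) i m = A [^] m"
proof -
  define f where "f j = inv (A [^] j) \<otimes> B \<otimes> A [^] j" for j :: nat
  have f: "f j \<in> carrier G" for j using A B by (simp add: f_def)
  have shift: "A \<otimes> f (Suc j) = f j \<otimes> A" for j
  proof -
    have "A [^] Suc j = A [^] j \<otimes> A" by simp
    then show ?thesis
      using A B by (simp add: f_def inv_mult_group m_assoc) (simp add: m_assoc[symmetric])
  qed
  have f_mod: "f (j mod n) = f j" for j
  proof -
    have "A [^] j = A [^] (n * (j div n) + j mod n)" by simp
    also have "\<dots> = A [^] (j mod n)"
      using A nat_pow_pow[OF A(1), of n "j div n", symmetric]
      by (simp only: nat_pow_mult[symmetric]) (simp add: nat_pow_one)
    finally show ?thesis by (simp add: f_def)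
  qed
  have seg: "gword_eval G f (toric_word n i m) = A [^] m" for i
  proof -
    have "f i \<otimes> inv A = inv (A [^] i) \<otimes> (B \<otimes> inv A) \<otimes> A [^] i"
    proof -
      have "A [^] i \<otimes> inv A = inv A \<otimes> A [^] i"
      proof -
        have "A [^] i \<otimes> inv A = inv A \<otimes> (A \<otimes> A [^] i) \<otimes> inv A"
          using A by (simp add: m_assoc[symmetric])
        also have "A \<otimes> A [^] i = A [^] i \<otimes> A"
          using A nat_pow_Suc2[of A i] by simp
        finally show ?thesis using A by (simp add: m_assoc)
      qed
      then have "inv (A [^] i) \<otimes> B \<otimes> (A [^] i \<otimes> inv A) = inv (A [^] i) \<otimes> B \<otimes> (inv A \<otimes> A [^] i)"
        by simp
      then show ?thesis using A B by (simp add: f_def m_assoc)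
    qed
    then have "(f i \<otimes> inv A) [^] m = \<one>"
      using A B BA by (simp add: pow_conj)
    then show ?thesis
      using seg_eq_pow[of f A i m, OF _ A(1) shift] f A by (simp add: gword_eval_toric_word f_mod image_subset_iff)
  qed
  have "gword_eval G f r = gword_eval G f s" if "(r, s) \<in> toric_relations k n m" for r s
  proof -
    from that consider i where "r = replicate k (i mod n, True)" "s = []"
      | i where "r = toric_word n 1 m" "s = toric_word n i m"
      by (auto simp: toric_relations_def)
    then show ?thesis
    proof cases
      case (1 i)
      have "f i [^] k = \<one>" using A B by (simp add: f_def pow_conj)
      then show ?thesis using 1 f by (simp add: gword_eval_replicate f_mod)
    next
      case 2
      then show ?thesis by (simp only: seg)
    qed
  qed
  then obtain h where h: "h \<in> hom (presented_group {0..<n} (toric_relations k n m)) G"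
    "\<And>w. w \<in> gwords {0..<n} \<Longrightarrow>
      h (gword_rel {0..<n} (toric_relations k n m) `` {w}) = gword_eval G f w"
    using presented_group_universal[of f "{0..<n}" "toric_relations k n m"] f by blast
  show thesis
  proof (rule that)
    show "h \<in> hom (toric_reflection_group k n m) G"
      using h(1) by (simp add: toric_reflection_group_def)
    show gen: "h (toric_gen k n m j) = inv (A [^] j) \<otimes> B \<otimes> A [^] j" for j
      using h(2)[of "[(j mod n, True)]"] \<open>0 < n\<close> f f_mod[of j]
      by (simp add: toric_gen_def f_def[symmetric])
    show "seg (\<lambda>j. h (toric_gen k n m j)) i m = A [^] m" for i
      using seg[of i] by (simp add: gen f_def[symmetric] gword_eval_toric_word f_mod)
  qed
qed

end

text \<open>Cancellation makes the class of a formal inverse the group inverse. Statements about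
  words thereby become statements about products of generators.\<close>

lemma presented_group_class_eq_eval:
  assumes "w \<in> gwords S"
  shows "gword_rel S R `` {w} =
    gword_eval (presented_group S R) (\<lambda>x. gword_rel S R `` {[(x, True)]}) w"
  using assms
proof (induction w)
  case Nil
  then show ?case by (simp add: presented_group_def)
next
  case (Cons a w)
  interpret P: group "presented_group S R" by (rule group_presented_group)
  obtain x b where a: "a = (x, b)" by (cases a)
  have car: "gword_rel S R `` {v} \<in> carrier (presented_group S R)" if "v \<in> gwords S" for v
    using that by (simp add: presented_group_def quotientI)
  have x: "[(x, b)] \<in> gwords S" for b using Cons.prems a by simp
  have "gword_rel S R `` {[(x, False)]} \<otimes>\<^bsub>presented_group S R\<^esub> gword_rel S R `` {[(x, True)]} =
      \<one>\<^bsub>presented_group S R\<^esub>"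
    using gword_rel.cancel[of "[]" S "[]" x False R] x
    by (simp add: presented_group_mult[OF x x]) (simp add: presented_group_def equiv_class_eq[OF equiv_gword_rel])
  then have "gword_rel S R `` {[(x, False)]} = inv\<^bsub>presented_group S R\<^esub> gword_rel S R `` {[(x, True)]}"
    using car x by (intro P.inv_equality[symmetric]) auto
  then have "gword_rel S R `` {[a]} = (if b then gword_rel S R `` {[(x, True)]}
      else inv\<^bsub>presented_group S R\<^esub> gword_rel S R `` {[(x, True)]})"
    using a by (cases b) auto
  moreover have "gword_rel S R `` {a # w} =
      gword_rel S R `` {[a]} \<otimes>\<^bsub>presented_group S R\<^esub> gword_rel S R `` {w}"
    using presented_group_mult[of "[a]" S w R] Cons.prems by simp
  ultimately show ?case using Cons a by simp
qed

lemma presented_group_generated: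
  assumes "subgroup H (presented_group S R)" "\<And>x. x \<in> S \<Longrightarrow> gword_rel S R `` {[(x, True)]} \<in> H"
  shows "H = carrier (presented_group S R)"
proof
  interpret P: group "presented_group S R" by (rule group_presented_group)
  interpret H: subgroup H "presented_group S R" by fact
  show "H \<subseteq> carrier (presented_group S R)" by (rule H.subset)
  show "carrier (presented_group S R) \<subseteq> H"
  proof
    fix g assume "g \<in> carrier (presented_group S R)"
    then obtain w where w: "w \<in> gwords S" and g: "g = gword_rel S R `` {w}"
      by (auto simp: presented_group_def elim: quotientE)
    have "gword_eval (presented_group S R) (\<lambda>x. gword_rel S R `` {[(x, True)]}) w \<in> H"
      using w by (induction w) (auto simp: assms(2))
    then show "g \<in> H" using g presented_group_class_eq_eval[OF w] by simp
  qed
qed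

context group
begin

text \<open>The last two facts are triangle relations for \<open>x i\<close> and
  \<open>y [^] p\<close>, valid up to powers of the central \<open>y [^] n\<close>.\<close>

lemma toric_relations_imp:
  fixes n m p s :: nat
  assumes x: "range x \<subseteq> carrier G" and periodic: "\<And>i. x (i + n) = x i"
    and y: "\<And>i. seg x i m = y" and ps: "p * m = 1 + s * n"
  shows "y [^] p \<otimes> x (Suc i) = x i \<otimes> y [^] p"
    and "y [^] n \<otimes> x i = x i \<otimes> y [^] n"
    and "seg x 1 n [^] m = y [^] n"
    and "(y [^] p) [^] n = (y [^] n) [^] p"
    and "(x i \<otimes> inv (y [^] p)) [^] m = inv ((y [^] n) [^] s)"
proof -
  have xi [simp]: "x i \<in> carrier G" for i using x by auto
  have yc [simp]: "y \<in> carrier G" using y[of 0] seg_closed[OF x, of 0 m] by simp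
  have periodic': "x (i + q * n) = x i" for i q
  proof (induction q)
    case (Suc q)
    have "x (i + Suc q * n) = x (i + q * n + n)" by (simp add: add_ac)
    then show ?case using Suc periodic by simp
  qed simp
  \<comment> \<open>A product of \<open>m + 1\<close> consecutive terms contains a block of
    \<open>m\<close> terms at either end.\<close>
  have shift: "y \<otimes> x (i + m) = x i \<otimes> y" for i
  proof -
    have "y \<otimes> x (i + m) = seg x i (m + 1)"
      using seg_add[OF x, of i m 1] by (simp add: y)
    also have "\<dots> = x i \<otimes> y" by (simp add: y)
    finally show ?thesis .
  qed
  have pow_shift: "y [^] q \<otimes> x (i + q * m) = x i \<otimes> y [^] q" for q i
  proof (induction q arbitrary: i)
    case (Suc q)
    have "y [^] Suc q \<otimes> x (i + Suc q * m) = y [^] q \<otimes> (y \<otimes> x (i + q * m + m))"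
      by (simp add: m_assoc add_ac)
    also have "\<dots> = y [^] q \<otimes> x (i + q * m) \<otimes> y"
      by (simp add: shift m_assoc)
    also have "\<dots> = x i \<otimes> y [^] Suc q" by (simp add: Suc m_assoc)
    finally show ?case .
  qed simp
  show 1: "y [^] p \<otimes> x (Suc i) = x i \<otimes> y [^] p" for i
    using pow_shift[of p i] periodic'[of "Suc i" s] by (simp add: ps)
  show "y [^] n \<otimes> x i = x i \<otimes> y [^] n"
    using pow_shift[of n i] periodic'[of i m] by (simp add: mult.commute)
  \<comment> \<open>The product of \<open>m * n\<close> terms is read once as \<open>m\<close>
    blocks of length \<open>n\<close> and once as \<open>n\<close> blocks of length
    \<open>m\<close>.\<close>
  have "seg x (1 + j * n) n = seg x 1 n" for j
    using periodic'[of "1 + _" j] by (intro seg_cong) (simp add: add_ac)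
  with x have "seg x 1 (m * n) = seg x 1 n [^] m" by (rule seg_mult)
  moreover have "seg x 1 (n * m) = y [^] n" using x y by (rule seg_mult)
  ultimately show "seg x 1 n [^] m = y [^] n" by (simp add: mult.commute)
  show "(y [^] p) [^] n = (y [^] n) [^] p"
    by (simp add: nat_pow_pow mult.commute)
  let ?u = "(x i \<otimes> inv (y [^] p)) [^] m"
  \<comment> \<open>Telescoping writes \<open>y\<close> as \<open>?u\<close> times the
    \<open>m\<close>-th power of \<open>y [^] p\<close>; since \<open>p * m = 1 + s * n\<close>,
    that power is \<open>y\<close> up to a power of \<open>y [^] n\<close>.\<close>
  have "y = ?u \<otimes> (y [^] p) [^] m"
    using seg_eq_pow[of x "y [^] p" i m] x 1 y by simp
  also have "(y [^] p) [^] m = (y [^] n) [^] s \<otimes> y"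
  proof -
    have "(y [^] p) [^] m = y [^] (n * s + 1)"
      by (simp add: nat_pow_pow ps mult.commute[of s n])
    then show ?thesis by (simp add: nat_pow_pow)
  qed
  finally have "?u \<otimes> (y [^] n) [^] s \<otimes> y = \<one> \<otimes> y" by (simp add: m_assoc)
  then have "?u \<otimes> (y [^] n) [^] s = \<one>" by (simp del: l_one)
  then show "?u = inv ((y [^] n) [^] s)" by (intro inv_equality[symmetric]) auto
qed

end

lemma (in group_hom) hom_seg:
  assumes "range x \<subseteq> carrier G"
  shows "h (G.seg x i l) = H.seg (\<lambda>j. h (x j)) i l"
  using assms by (induction l arbitrary: i) (auto simp: image_subset_iff)

text \<open>The presentation is restated for a periodic sequence over all natural numbers, with the
  relations at every index.\<close>

lemma toric_group:
  fixes k n m :: nat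
  assumes "0 < n"
  defines "W \<equiv> toric_reflection_group k n m" and "x \<equiv> toric_gen k n m"
  shows "group W" "range x \<subseteq> carrier W" "x (i + n) = x i" "x i [^]\<^bsub>W\<^esub> k = \<one>\<^bsub>W\<^esub>"
    "group.seg W x i m = group.seg W x 1 m"
    "toric_c k n m = group.seg W x 1 n [^]\<^bsub>W\<^esub> m"
    and "\<And>H. subgroup H W \<Longrightarrow> range x \<subseteq> H \<Longrightarrow> H = carrier W"
proof -
  let ?S = "{0..<n}" and ?R = "toric_relations k n m"
  have W: "W = presented_group ?S ?R" by (simp add: W_def toric_reflection_group_def)
  show "group W" unfolding W by (rule group_presented_group)
  then interpret group W .
  show car: "range x \<subseteq> carrier W"
    using \<open>0 < n\<close> by (auto simp: W x_def toric_gen_def presented_group_def intro!: quotientI)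
  then have xi: "x i \<in> carrier W" for i by auto
  show periodic: "x (i + n) = x i" for i by (simp add: x_def toric_gen_def)
  have x_mod: "x (i mod n) = x i" for i by (simp add: x_def toric_gen_def)
  have rel: "gword_eval W x r = gword_eval W x s"
    if rs: "(r, s) \<in> ?R" "r \<in> gwords ?S" "s \<in> gwords ?S" for r s
  proof -
    have "(r, s) \<in> gword_rel ?S ?R"
      using gword_rel.relation[of "[]" ?S "[]" r s ?R] rs by simp
    then have "gword_rel ?S ?R `` {r} = gword_rel ?S ?R `` {s}"
      by (rule equiv_class_eq[OF equiv_gword_rel])
    moreover have "gword_rel ?S ?R `` {w} = gword_eval W x w" if "w \<in> gwords ?S" for w
    proof -
      have "gword_eval W (\<lambda>i. gword_rel ?S ?R `` {[(i, True)]}) w = gword_eval W x w"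
        using that by (induction w) (auto simp: x_def toric_gen_def)
      then show ?thesis using presented_group_class_eq_eval[OF that] by (simp add: W)
    qed
    ultimately show ?thesis using rs by simp
  qed
  have words: "toric_word n i l \<in> gwords ?S" "replicate q (i mod n, True) \<in> gwords ?S" for i l q
    using \<open>0 < n\<close> by (auto simp: toric_word_def gwords_def)
  \<comment> \<open>Relations are indexed by \<open>1..n\<close>, so residue 0 is represented by
    \<open>n\<close>.\<close>
  have representative: "\<exists>i'\<in>{1..n}. i' mod n = i mod n" for i
  proof (cases "i mod n = 0")
    case True
    then show ?thesis using \<open>0 < n\<close> by (intro bexI[of _ n]) auto
  next
    case False
    then show ?thesis using \<open>0 < n\<close> by (intro bexI[of _ "i mod n"]) auto
  qed
  obtain i' where i': "i' \<in> {1..n}" "i' mod n = i mod n" using representative by blast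
  have "x i = x i'" using i'(2) x_mod by metis
  moreover have "(replicate k (i' mod n, True), []) \<in> ?R"
    unfolding toric_relations_def using i' by blast
  from rel[OF this words(2)] have "x i' [^]\<^bsub>W\<^esub> k = \<one>\<^bsub>W\<^esub>"
    using xi by (simp add: gword_eval_replicate x_mod)
  ultimately show "x i [^]\<^bsub>W\<^esub> k = \<one>\<^bsub>W\<^esub>" by simp
  have "x (i + d) = x (i' + d)" for d
    using i'(2) x_mod by (metis mod_add_left_eq)
  then have "seg x i m = seg x i' m" by (rule seg_cong)
  also have "\<dots> = seg x 1 m"
  proof (cases "i' = 1")
    case False
    then have "(toric_word n 1 m, toric_word n i' m) \<in> ?R"
      using i' by (auto simp: toric_relations_def)
    from rel[OF this words(1) words(1)] show ?thesis
      by (simp add: gword_eval_toric_word x_mod)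
  qed simp
  finally show "seg x i m = seg x 1 m" .
  have "foldr (monoid.mult W) (map x [i..<i + l]) \<one>\<^bsub>W\<^esub> = seg x i l" for i l
  proof (induction l arbitrary: i)
    case (Suc l)
    show ?case using Suc[of "Suc i"] by (simp add: upt_conv_Cons del: upt_Suc)
  qed simp
  from this[of 1 n] show "toric_c k n m = seg x 1 n [^]\<^bsub>W\<^esub> m"
    by (simp add: toric_c_def W_def[symmetric] x_def[symmetric] add.commute del: upt_Suc)
  show "H = carrier W" if "subgroup H W" "range x \<subseteq> H" for H
    unfolding W
  proof (rule presented_group_generated)
    show "subgroup H (presented_group ?S ?R)" using that W by simp
    show "gword_rel ?S ?R `` {[(j, True)]} \<in> H" if "j \<in> ?S" for j
    proof -
      have "x j \<in> H" using \<open>range x \<subseteq> H\<close> by auto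
      then show ?thesis using that by (simp add: x_def toric_gen_def)
    qed
  qed
qed

subsection \<open>The center\<close>

text \<open>The entries are the exponents for \<open>Y = r1 r2\<close>, \<open>x = r3 r2\<close> and
  the remaining product \<open>r3 r1\<close>, which is \<open>x\<close> times the inverse of
  \<open>Y\<close>.\<close>

definition triangle_matrix_of :: "nat \<Rightarrow> nat \<Rightarrow> nat \<Rightarrow> 3 \<Rightarrow> 3 \<Rightarrow> nat" where
  "triangle_matrix_of k n m i j =
    (if i = j then 1 else if {i, j} = {1, 2} then n else if {i, j} = {2, 3} then k else m)"

lemma triangle_matrix_triangle_matrix_of:
  assumes "2 \<le> k" "2 \<le> n" "2 \<le> m"
  shows "triangle_matrix (triangle_matrix_of k n m)"
  by unfold_locales (use assms in \<open>auto simp: triangle_matrix_of_def insert_commute\<close>)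

lemma BijGroup_UNIV_simps:
  "carrier (BijGroup UNIV) = {f. bij f}" "\<one>\<^bsub>BijGroup UNIV\<^esub> = id"
  "bij f \<Longrightarrow> bij g \<Longrightarrow> f \<otimes>\<^bsub>BijGroup UNIV\<^esub> g = f \<circ> g"
  by (auto simp: BijGroup_def Bij_def compose_def fun_eq_iff)

lemma BijGroup_UNIV_pow:
  assumes "bij f"
  shows "f [^]\<^bsub>BijGroup UNIV\<^esub> (q::nat) = f ^^ q"
proof (induction q)
  case 0
  interpret group "BijGroup UNIV :: ('a \<Rightarrow> 'a) monoid" by (rule group_BijGroup)
  show ?case by (simp add: BijGroup_UNIV_simps)
next
  case (Suc q)
  interpret group "BijGroup UNIV :: ('a \<Rightarrow> 'a) monoid" by (rule group_BijGroup)
  have "f ^^ Suc q = (f ^^ q) \<circ> f" by (simp add: funpow_Suc_right del: funpow.simps)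
  then show ?case
    using Suc assms by (simp add: BijGroup_UNIV_simps bij_betw_funpow del: funpow.simps)
qed

text \<open>One even word \<open>w\<close> describes \<open>g\<close> both in the geometric
  representation and in \<open>Q\<close>. Centrality makes \<open>w\<close> trivial as a Coxeter
  word, hence also in \<open>Q\<close>. The quotient by the powers of \<open>c\<close> is the
  intended \<open>Q\<close>.\<close>

lemma toric_center_in_kernel:
  fixes k n m :: nat
  assumes "2 \<le> k" and "2 \<le> n" and "n < m" and "coprime n m"
    and hom: "group_hom (toric_reflection_group k n m) Q \<pi>" and \<pi>_c: "\<pi> (toric_c k n m) = \<one>\<^bsub>Q\<^esub>"
    and g: "g \<in> group_center (toric_reflection_group k n m)"
  shows "\<pi> g = \<one>\<^bsub>Q\<^esub>"
proof -
  define W where "W = toric_reflection_group k n m"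
  define x where "x = toric_gen k n m"
  have n0: "0 < n" using \<open>2 \<le> n\<close> by simp
  note W = toric_group[OF n0, where k = k and m = m, folded W_def x_def]
  interpret W: group W by (rule W(1))
  interpret Q: group Q using hom by (rule group_hom.axioms)
  interpret \<pi>: group_hom W Q \<pi> using hom by (simp add: W_def)
  note x = W(2)
  then have xi [simp]: "x i \<in> carrier W" for i by auto
  obtain p s where ps: "p * m = 1 + s * n"
  proof -
    obtain p s where "m * p = n * s + gcd m n"
      using bezout_nat[of m n] \<open>n < m\<close> by auto
    with \<open>coprime n m\<close> show thesis
      using that[of p s] by (simp add: coprime_commute mult.commute)
  qed
  define y where "y = W.seg x 1 m"
  have y: "W.seg x i m = y" for i unfolding y_def by (rule W(5))
  have yc [simp]: "y \<in> carrier W" unfolding y_def using x by simp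
  note rels = W.toric_relations_imp[OF x W(3) y ps]
  define c where "c = y [^]\<^bsub>W\<^esub> n"
  have c: "toric_c k n m = c" unfolding W(6) c_def by (rule rels(3))
  have cc [simp]: "c \<in> carrier W" by (simp add: c_def)
  define Y where "Y = y [^]\<^bsub>W\<^esub> p"
  have Yc [simp]: "Y \<in> carrier W" by (simp add: Y_def)
  have \<pi>_c_pow: "\<pi> (c [^]\<^bsub>W\<^esub> q) = \<one>\<^bsub>Q\<^esub>" for q :: nat
    using \<pi>_c by (simp add: c \<pi>.hom_nat_pow)

  let ?M = "triangle_matrix_of k n m"
  interpret M: triangle_matrix ?M
    using assms by (intro triangle_matrix_triangle_matrix_of) auto
  have M: "?M 1 2 = n" "?M 3 2 = k" "?M 1 3 = m"
    by (simp_all add: triangle_matrix_of_def doubleton_eq_iff)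

  \<comment> \<open>These are the elements \<open>r1 t\<close>, \<open>r2 t\<close>,
    \<open>r3 t\<close> for the choice \<open>t = r2\<close>.\<close>
  define b where
    "b = (\<lambda>_ :: 3. \<one>\<^bsub>Q\<^esub>)(1 := \<pi> Y, 3 := \<pi> (x 0))"
  have b: "b 1 = \<pi> Y" "b 2 = \<one>\<^bsub>Q\<^esub>" "b 3 = \<pi> (x 0)"
    by (simp_all add: b_def)
  have b_car: "range b \<subseteq> carrier (Q)"
  proof -
    have "b i \<in> carrier (Q)" for i
      using exhaust_3[of i] b by auto
    then show ?thesis by auto
  qed
  have b_rel: "(b i \<otimes>\<^bsub>Q\<^esub> inv\<^bsub>Q\<^esub> b j) [^]\<^bsub>Q\<^esub> ?M i j = \<one>\<^bsub>Q\<^esub>" for i j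
  proof -
    let ?P = "\<lambda>i j. (b i \<otimes>\<^bsub>Q\<^esub> inv\<^bsub>Q\<^esub> b j) [^]\<^bsub>Q\<^esub> ?M i j = \<one>\<^bsub>Q\<^esub>"
    have bi: "b i \<in> carrier (Q)" for i using b_car by auto
    have swap: "?P j i" if "?P i j" for i j
    proof -
      have "b j \<otimes>\<^bsub>Q\<^esub> inv\<^bsub>Q\<^esub> b i = inv\<^bsub>Q\<^esub> (b i \<otimes>\<^bsub>Q\<^esub> inv\<^bsub>Q\<^esub> b j)"
        using bi by (simp add: Q.inv_mult_group)
      then show ?thesis using that bi M.M_sym[of i j] by (simp add: Q.nat_pow_inv)
    qed
    have "\<pi> (Y [^]\<^bsub>W\<^esub> n) = \<one>\<^bsub>Q\<^esub>"
      unfolding Y_def rels(4) c_def[symmetric] by (rule \<pi>_c_pow)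
    then have "?P 1 2" by (simp add: b M \<pi>.hom_nat_pow)
    moreover have "\<pi> (x 0 [^]\<^bsub>W\<^esub> k) = \<one>\<^bsub>Q\<^esub>" by (simp add: W(4))
    then have "?P 3 2" by (simp add: b M \<pi>.hom_nat_pow)
    \<comment> \<open>This power is the inverse of a power of \<open>c\<close>, which \<pi>
      kills.\<close>
    moreover have "\<pi> ((x 0 \<otimes>\<^bsub>W\<^esub> inv\<^bsub>W\<^esub> Y) [^]\<^bsub>W\<^esub> m) = \<one>\<^bsub>Q\<^esub>"
      unfolding Y_def rels(5) c_def[symmetric] using \<pi>_c_pow[of s] by (simp add: \<pi>.hom_inv)
    then have "?P 3 1" using M.M_sym[of 3 1] by (simp add: b M \<pi>.hom_nat_pow)
    moreover have "?P i i" using bi by (simp add: M.diag)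
    ultimately show ?thesis
      using exhaust_3[of i] exhaust_3[of j] swap[of 1 2] swap[of 3 2] swap[of 3 1] by (elim disjE) (simp_all only:)
  qed

  let ?B = "BijGroup (UNIV :: (real^3) set)"
  interpret B: group ?B by (rule group_BijGroup)
  have act_car: "M.act w \<in> carrier ?B" for w by (simp add: BijGroup_UNIV_simps M.bij_act)
  have act_append: "M.act (u @ w) = M.act u \<otimes>\<^bsub>?B\<^esub> M.act w" for u w
    by (simp add: BijGroup_UNIV_simps M.bij_act M.act_append)
  have act_rev: "M.act (rev w) = inv\<^bsub>?B\<^esub> M.act w" for w
  proof -
    have "M.act (rev w) \<otimes>\<^bsub>?B\<^esub> M.act w = \<one>\<^bsub>?B\<^esub>"
      by (simp add: BijGroup_UNIV_simps M.bij_act fun_eq_iff)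
    then show ?thesis using act_car by (intro B.inv_equality[symmetric])
  qed
  have act_pow: "M.act [i, j] [^]\<^bsub>?B\<^esub> ?M i j = \<one>\<^bsub>?B\<^esub>" for i j
    using M.rotation_order[of i j]
    by (simp add: BijGroup_UNIV_pow M.bij_act BijGroup_UNIV_simps del: M.act_Cons) simp
  define A where "A = M.act [1, 2]"
  define D where "D = M.act [3, 2]"
  have AD: "A \<in> carrier ?B" "D \<in> carrier ?B" unfolding A_def D_def by (rule act_car)+
  have A_pow: "A [^]\<^bsub>?B\<^esub> n = \<one>\<^bsub>?B\<^esub>" using act_pow[of 1 2] by (simp add: A_def M del: M.act_Cons)
  have D_pow: "D [^]\<^bsub>?B\<^esub> k = \<one>\<^bsub>?B\<^esub>" using act_pow[of 3 2] by (simp add: D_def M del: M.act_Cons)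
  have "D \<otimes>\<^bsub>?B\<^esub> inv\<^bsub>?B\<^esub> A = M.act ([3, 2] @ [2, 1])"
    unfolding act_append using act_rev[of "[1, 2]"] by (simp add: A_def D_def del: M.act_Cons)
  also have "\<dots> = M.act [3, 1]" by (simp add: fun_eq_iff)
  finally have DA_pow: "(D \<otimes>\<^bsub>?B\<^esub> inv\<^bsub>?B\<^esub> A) [^]\<^bsub>?B\<^esub> m = \<one>\<^bsub>?B\<^esub>"
    using act_pow[of 3 1] M.M_sym[of 3 1] by (simp add: M del: M.act_Cons)
  obtain h where h_hom: "h \<in> hom W ?B"
    and hx: "h (x j) = inv\<^bsub>?B\<^esub> (A [^]\<^bsub>?B\<^esub> j) \<otimes>\<^bsub>?B\<^esub> D \<otimes>\<^bsub>?B\<^esub> A [^]\<^bsub>?B\<^esub> j"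
    and h_seg: "B.seg (\<lambda>j. h (x j)) i m = A [^]\<^bsub>?B\<^esub> m" for i j
    using B.toric_hom[OF AD(1) A_pow AD(2) D_pow DA_pow n0] unfolding W_def x_def by metis
  interpret h: group_hom W ?B h
    using W.group_axioms B.group_axioms h_hom by (simp add: group_hom_def group_hom_axioms_def)
  have h_x0: "h (x 0) = D" using hx[of 0] AD by simp
  \<comment> \<open>\<open>h\<close> sends \<open>y\<close> to the \<open>m\<close>-th power of
    \<open>A\<close>; as \<open>p * m = 1 + s * n\<close> and \<open>A\<close> has trivial
    \<open>n\<close>-th power, \<open>Y\<close> goes to \<open>A\<close>.\<close>
  have hY: "h Y = A"
  proof -
    have "h y = A [^]\<^bsub>?B\<^esub> m"
      using h.hom_seg[OF x, of 1 m] h_seg[of 1] by (simp add: y)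
    then have "h Y = A [^]\<^bsub>?B\<^esub> (p * m)"
      using AD by (simp add: Y_def h.hom_nat_pow B.nat_pow_pow mult.commute)
    also have "\<dots> = A \<otimes>\<^bsub>?B\<^esub> (A [^]\<^bsub>?B\<^esub> n) [^]\<^bsub>?B\<^esub> s"
      unfolding ps using AD by (simp only: B.nat_pow_mult[symmetric] B.nat_pow_pow mult.commute[of s]) simp
    finally show ?thesis using AD by (simp add: A_pow)
  qed

  \<comment> \<open>\<open>H\<close> collects the elements described by one even word under both
    \<open>h\<close> and \<pi>. Proving \<open>H\<close> to be all of \<open>W\<close> replaces the
    construction of a map from the even Coxeter subgroup to \<open>Q\<close>.\<close>
  define H where "H = {g \<in> carrier W. \<exists>w. even (length w) \<and> h g = M.act w \<and>
    \<pi> g = Q.alternating_prod b True w}"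
  have alt_append: "Q.alternating_prod b True (u @ w) =
      Q.alternating_prod b True u \<otimes>\<^bsub>Q\<^esub> Q.alternating_prod b True w"
    if "even (length u)" for u w
    using that Q.alternating_prod_append[OF b_car, of True u w] by simp
  note alt_closed = Q.alternating_prod_closed[OF b_car]
  have "subgroup H W"
  proof (rule W.subgroupI)
    show "H \<subseteq> carrier W" by (auto simp: H_def)
    have "\<one>\<^bsub>W\<^esub> \<in> H"
      by (auto simp: H_def BijGroup_UNIV_simps intro!: exI[of _ "[]"])
    then show "H \<noteq> {}" by auto
  next
    fix g assume "g \<in> H"
    then obtain w where g: "g \<in> carrier W" and w: "even (length w)" "h g = M.act w"
      "\<pi> g = Q.alternating_prod b True w" by (auto simp: H_def)
    have "Q.alternating_prod b True w \<otimes>\<^bsub>Q\<^esub> Q.alternating_prod b True (rev w) = \<one>\<^bsub>Q\<^esub>"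
      using M.alternating_prod_respects[OF Q.group_axioms b_car b_rel M.cox_eq_rev[of w], of True]
        alt_append[OF w(1)] by simp
    then have "inv\<^bsub>Q\<^esub> Q.alternating_prod b True (rev w) = Q.alternating_prod b True w"
      using alt_closed by (intro Q.inv_equality)
    then have "\<pi> (inv\<^bsub>W\<^esub> g) = Q.alternating_prod b True (rev w)"
      using alt_closed[of True "rev w"] g w(3) by (metis Q.inv_inv \<pi>.hom_inv)
    then show "inv\<^bsub>W\<^esub> g \<in> H"
      using g w act_rev[of w] by (auto simp: H_def intro!: exI[of _ "rev w"])
  next
    fix f g assume "f \<in> H" "g \<in> H"
    then obtain u w where f: "f \<in> carrier W" and u: "even (length u)" "h f = M.act u"
        "\<pi> f = Q.alternating_prod b True u"
      and g: "g \<in> carrier W" and w: "even (length w)" "h g = M.act w"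
        "\<pi> g = Q.alternating_prod b True w"
      unfolding H_def by blast
    then show "f \<otimes>\<^bsub>W\<^esub> g \<in> H"
      unfolding H_def by (auto simp: act_append alt_append intro!: exI[of _ "u @ w"])
  qed
  then interpret H: subgroup H W .
  have "x 0 \<in> H"
  proof -
    have "Q.alternating_prod b True [3, 2] = \<pi> (x 0)" by (simp add: b)
    with h_x0 show ?thesis
      unfolding H_def D_def by (intro CollectI conjI exI[of _ "[3, 2]"]) simp_all
  qed
  moreover have "Y \<in> H"
  proof -
    have "Q.alternating_prod b True [1, 2] = \<pi> Y" by (simp add: b)
    with hY show ?thesis
      unfolding H_def A_def by (intro CollectI conjI exI[of _ "[1, 2]"]) simp_all
  qed
  ultimately have "x i \<in> H" for i
  proof (induction i)
    case (Suc i)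
    \<comment> \<open>Conjugation by \<open>Y\<close> shifts the index, so \<open>x 0\<close> and
      \<open>Y\<close> yield all generators.\<close>
    have "x (Suc i) = inv\<^bsub>W\<^esub> Y \<otimes>\<^bsub>W\<^esub> (x i \<otimes>\<^bsub>W\<^esub> Y)"
      using rels(1)[of i] by (simp add: Y_def W.inv_solve_left)
    then show ?case using Suc by simp
  qed
  then have "range x \<subseteq> H" by auto
  then have H: "H = carrier W" using \<open>subgroup H W\<close> by (intro W(7))
  have g: "g \<in> carrier W" and g_comm: "\<And>z. z \<in> carrier W \<Longrightarrow> g \<otimes>\<^bsub>W\<^esub> z = z \<otimes>\<^bsub>W\<^esub> g"
    using g by (auto simp: group_center_def W_def)
  have "g \<in> H" using g H by (simp only:)
  then obtain w where w: "even (length w)" "h g = M.act w" "\<pi> g = Q.alternating_prod b True w"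
    unfolding H_def by blast
  have comm: "M.act w (M.act u v) = M.act u (M.act w v)" if "h z = M.act u" "z \<in> carrier W" for u v z
  proof -
    have "M.act w \<otimes>\<^bsub>?B\<^esub> M.act u = M.act u \<otimes>\<^bsub>?B\<^esub> M.act w"
      using g_comm[OF that(2)] h.hom_mult[OF g that(2)] h.hom_mult[OF that(2) g] w(2) that(1)
      by simp
    then show ?thesis by (simp add: BijGroup_UNIV_simps M.bij_act fun_eq_iff)
  qed
  have "M.cox_eq w []"
  proof (rule M.commuting_trivial)
    show "even (length w)" by fact
    show "M.act w (M.reflection 1 (M.reflection 2 v)) = M.reflection 1 (M.reflection 2 (M.act w v))" for v
      using comm[of Y "[1, 2]" v] hY by (simp add: A_def)
    show "M.act w (M.reflection 3 (M.reflection 2 v)) = M.reflection 3 (M.reflection 2 (M.act w v))" for v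
      using comm[of "x 0" "[3, 2]" v] h_x0 by (simp add: D_def)
    show "2 < ?M 1 3" using assms by (simp add: M)
    show "2 < ?M 1 2 \<or> 2 < ?M 3 2 \<or> odd (?M 1 3)"
      \<comment> \<open>For \<open>n = 2\<close>, coprimality makes \<open>m\<close> odd; otherwise
        \<open>2 < n\<close>.\<close>
      unfolding M using assms by (cases "n = 2") auto
  qed
  then show ?thesis
    using M.alternating_prod_respects[OF Q.group_axioms b_car b_rel] w(3) by simp
qed

theorem corollary1p6:
  fixes k n m :: nat
  assumes "2 \<le> k" and "2 \<le> n" and "2 \<le> m" and "n < m" and "coprime n m"
  shows "let W = toric_reflection_group k n m in
    cyclic_group (W\<lparr>carrier := group_center W\<rparr>) \<and>
    group_center W = generate W {toric_c k n m}"
proof -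
  define W where "W = toric_reflection_group k n m"
  define x where "x = toric_gen k n m"
  have n0: "0 < n" using \<open>2 \<le> n\<close> by simp
  note W = toric_group[OF n0, where k = k and m = m, folded W_def x_def]
  interpret W: group W by (rule W(1))
  note x = W(2)
  then have xi [simp]: "x i \<in> carrier W" for i by auto
  obtain p s where ps: "p * m = 1 + s * n"
  proof -
    obtain p s where "m * p = n * s + gcd m n"
      using bezout_nat[of m n] \<open>2 \<le> m\<close> by auto
    with \<open>coprime n m\<close> show thesis
      using that[of p s] by (simp add: coprime_commute mult.commute)
  qed
  define y where "y = W.seg x 1 m"
  have y: "W.seg x i m = y" for i unfolding y_def by (rule W(5))
  have yc [simp]: "y \<in> carrier W" unfolding y_def using x by simp
  note rels = W.toric_relations_imp[OF x W(3) y ps]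
  define c where "c = y [^]\<^bsub>W\<^esub> n"
  have c: "toric_c k n m = c" unfolding W(6) c_def by (rule rels(3))
  have cc [simp]: "c \<in> carrier W" by (simp add: c_def)
  define Z where "Z = generate W {c}"
  have Z: "subgroup Z W" unfolding Z_def by (rule W.generate_is_subgroup) simp
  \<comment> \<open>The centralizer of \<open>c\<close> is a subgroup, so containing the generators
    makes it everything.\<close>
  have "range x \<subseteq> {g \<in> carrier W. c \<otimes>\<^bsub>W\<^esub> g = g \<otimes>\<^bsub>W\<^esub> c}"
    using rels(2) by (auto simp: c_def)
  then have "{g \<in> carrier W. c \<otimes>\<^bsub>W\<^esub> g = g \<otimes>\<^bsub>W\<^esub> c} = carrier W"
    by (intro W(7) W.subgroup_centralizer cc)
  then have "c \<otimes>\<^bsub>W\<^esub> g = g \<otimes>\<^bsub>W\<^esub> c" if "g \<in> carrier W" for g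
    using that by blast
  then have "Z \<subseteq> {z \<in> carrier W. g \<otimes>\<^bsub>W\<^esub> z = z \<otimes>\<^bsub>W\<^esub> g}" if "g \<in> carrier W" for g
    unfolding Z_def using that
    by (intro W.generate_subgroup_incl W.subgroup_centralizer) auto
  then have Z_comm: "g \<otimes>\<^bsub>W\<^esub> z = z \<otimes>\<^bsub>W\<^esub> g" if "g \<in> carrier W" "z \<in> Z" for g z
    using that by auto
  have Z_sub: "Z \<subseteq> carrier W" using Z by (rule subgroup.subset)
  have Z_central: "Z \<subseteq> group_center W"
    using Z_sub Z_comm by (auto simp: group_center_def)
  have cZ: "c \<in> Z" by (simp add: Z_def generate.incl)
  have "Z \<lhd> W"
  proof (rule W.normal_invI[OF Z])
    fix g z assume "g \<in> carrier W" "z \<in> Z"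
    then show "g \<otimes>\<^bsub>W\<^esub> z \<otimes>\<^bsub>W\<^esub> inv\<^bsub>W\<^esub> g \<in> Z"
      using Z_comm[of g z] Z_sub by (auto simp: W.m_assoc)
  qed
  then interpret Z: normal Z W .
  interpret Q: group "W Mod Z" by (rule Z.factorgroup_is_group)
  define \<pi> where "\<pi> = (\<lambda>g. Z #>\<^bsub>W\<^esub> g)"
  interpret \<pi>: group_hom W "W Mod Z" \<pi>
    unfolding \<pi>_def using W.group_axioms Q.group_axioms Z.r_coset_hom_Mod
    by (simp add: group_hom_def group_hom_axioms_def)
  have one_Q: "\<one>\<^bsub>W Mod Z\<^esub> = Z" by (simp add: FactGroup_def)
  have \<pi>_Z: "\<pi> z = \<one>\<^bsub>W Mod Z\<^esub>" if "z \<in> Z" for z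
    using W.coset_join2[of z Z] that Z Z_sub by (auto simp: \<pi>_def one_Q)
  have ker_\<pi>: "z \<in> Z" if "z \<in> carrier W" "\<pi> z = \<one>\<^bsub>W Mod Z\<^esub>" for z
    using W.rcos_self[OF that(1) Z] that(2) by (simp add: \<pi>_def one_Q)

  have "group_center W \<subseteq> Z"
  proof
    fix g assume g: "g \<in> group_center W"
    \<comment> \<open>The quotient map by \<open>Z\<close> kills \<open>c\<close> and has kernel
      \<open>Z\<close>, so every central element lies in \<open>Z\<close>.\<close>
    have "\<pi> (toric_c k n m) = \<one>\<^bsub>W Mod Z\<^esub>" unfolding c by (rule \<pi>_Z) (rule cZ)
    then have "\<pi> g = \<one>\<^bsub>W Mod Z\<^esub>"
      using g unfolding W_def
      by (rule toric_center_in_kernel[OF assms(1,2,4,5) \<pi>.group_hom_axioms[unfolded W_def]])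
    then show "g \<in> Z" using g by (intro ker_\<pi>) (auto simp: group_center_def)
  qed
  with Z_central have center: "group_center W = generate W {c}" by (auto simp: Z_def)
  have "W\<lparr>carrier := group_center W\<rparr> = subgroup_generated W {c}"
    by (simp add: subgroup_generated_def center)
  then show ?thesis
    using center W.cyclic_group_generated[of c] by (simp add: Let_def W_def[symmetric] c)
qed

end
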